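(* There is an algorithm that, given a binary cotree of a cograph $G$ with $n$ vertices, computes $\mathrm{tcl}(G)$ in $O(n)$ time.
   Context: All graphs are finite, simple and undirected. For graphs $G=(V,E)$, $H=(W,F)$ on disjoint vertex sets, the disjoint union is $(V\cup W,E\cup F)$ and the join is $(V\cup W,E\cup F\cup\{vw:v\in V,w\in W\})$. Cographs are the graphs obtained from single vertices by repeated disjoint unions and joins. A binary cotree of a cograph $G$ is a rooted tree whose leaves are the vertices of $G$ and whose internal nodes have exactly two children and a label in $\{0,1\}$, a $0$-node representing the disjoint union and a $1$-node the join of the cographs of its children, the root representing $G$. For $X\subseteq V(G)$, $\mathrm{vcc}(X)$ is the minimum number of cliques of $G$ whose union is $X$. A tree decomposition of $G$ is a pair $(T,\{X_t\})$ with $T$ a tree and bags $X_t\subseteq V(G)$ such that every vertex lies in some bag, both endpoints of every edge lie in a common bag, and for every vertex $v$ the nodes $t$ with $v\in X_t$ induce a connected subtree. An augmented tree decomposition additionally assigns to each node $t$ a collection $C_t$ of cliques of $G$ whose union is $X_t$; its width is $\max_t|C_t|$. The tree-clique width $\mathrm{tcl}(G)$ is the minimum width of an augmented tree decomposition of $G$, i.e. the minimum over tree decompositions of $\max_t \mathrm{vcc}(X_t)$. *)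

theory Defs
  imports Complex_Main "HOL-Library.Ramsey" "HOL-Library.Landau_Symbols"
begin

section \<open>Graphs\<close>

type_synonym 'v graph = "'v set \<times> 'v set set"

abbreviation verts :: "'v graph \<Rightarrow> 'v set" where "verts \<equiv> fst"
abbreviation edges :: "'v graph \<Rightarrow> 'v set set" where "edges \<equiv> snd"

definition simple_graph :: "'v graph \<Rightarrow> bool" where
  "simple_graph G \<longleftrightarrow>
     finite (verts G) \<and> edges G \<subseteq> {{u, v} | u v. u \<in> verts G \<and> v \<in> verts G \<and> u \<noteq> v}"

definition disjoint_union :: "'v graph \<Rightarrow> 'v graph \<Rightarrow> 'v graph" where
  "disjoint_union G H = (verts G \<union> verts H, edges G \<union> edges H)"

definition join :: "'v graph \<Rightarrow> 'v graph \<Rightarrow> 'v graph" where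
  "join G H = (verts G \<union> verts H,
     edges G \<union> edges H \<union> {{v, w} | v w. v \<in> verts G \<and> w \<in> verts H})"

definition induced :: "'v graph \<Rightarrow> 'v set \<Rightarrow> 'v graph" where
  "induced G S = (verts G \<inter> S, {e \<in> edges G. e \<subseteq> S})"

definition connected_graph :: "'v graph \<Rightarrow> bool" where
  "connected_graph G \<longleftrightarrow> verts G \<noteq> {} \<and>
     (\<forall>u\<in>verts G. \<forall>v\<in>verts G. (u, v) \<in> {(x, y). {x, y} \<in> edges G}\<^sup>*)"

definition is_cycle :: "'v graph \<Rightarrow> 'v list \<Rightarrow> bool" where
  "is_cycle G p \<longleftrightarrow> 3 \<le> length p \<and> distinct p \<and>
     (\<forall>i<length p. {p ! i, p ! (Suc i mod length p)} \<in> edges G)"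

definition is_tree :: "'v graph \<Rightarrow> bool" where
  "is_tree T \<longleftrightarrow> simple_graph T \<and> connected_graph T \<and> (\<nexists>p. is_cycle T p)"

definition is_clique :: "'v graph \<Rightarrow> 'v set \<Rightarrow> bool" where
  "is_clique G K \<longleftrightarrow> K \<subseteq> verts G \<and> clique K (edges G)"


section \<open>Cographs and binary cotrees\<close>

inductive cograph :: "'v graph \<Rightarrow> bool" where
  vertex: "cograph ({v}, {})"
| union: "cograph G \<Longrightarrow> cograph H \<Longrightarrow> verts G \<inter> verts H = {} \<Longrightarrow> cograph (disjoint_union G H)"
| join: "cograph G \<Longrightarrow> cograph H \<Longrightarrow> verts G \<inter> verts H = {} \<Longrightarrow> cograph (join G H)"

datatype 'v cotree =
    Leaf 'v
  | Node0 "'v cotree" "'v cotree"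
  | Node1 "'v cotree" "'v cotree"

inductive binary_cotree :: "'v cotree \<Rightarrow> 'v graph \<Rightarrow> bool" where
  Leaf: "binary_cotree (Leaf v) ({v}, {})"
| Node0: "binary_cotree l G \<Longrightarrow> binary_cotree r H \<Longrightarrow> verts G \<inter> verts H = {} \<Longrightarrow>
    binary_cotree (Node0 l r) (disjoint_union G H)"
| Node1: "binary_cotree l G \<Longrightarrow> binary_cotree r H \<Longrightarrow> verts G \<inter> verts H = {} \<Longrightarrow>
    binary_cotree (Node1 l r) (join G H)"

fun num_nodes :: "'v cotree \<Rightarrow> nat" where
  "num_nodes (Leaf v) = 1"
| "num_nodes (Node0 l r) = 1 + num_nodes l + num_nodes r"
| "num_nodes (Node1 l r) = 1 + num_nodes l + num_nodes r"

lemma binary_cotree_imp_cograph: "binary_cotree t G \<Longrightarrow> cograph G"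
  by (induction rule: binary_cotree.induct) (auto intro: cograph.intros)

lemma cograph_iff_binary_cotree: "cograph G \<longleftrightarrow> (\<exists>t. binary_cotree t G)"
proof
  show "\<exists>t. binary_cotree t G" if "cograph G"
    using that by (induction rule: cograph.induct) (blast intro: binary_cotree.intros)+
qed (blast intro: binary_cotree_imp_cograph)

lemma simple_graph_iff:
  "simple_graph G \<longleftrightarrow> finite (verts G) \<and>
     (\<forall>e\<in>edges G. \<exists>u\<in>verts G. \<exists>v\<in>verts G. u \<noteq> v \<and> e = {u, v})"
  unfolding simple_graph_def by blast

lemma cograph_imp_simple_graph: "cograph G \<Longrightarrow> simple_graph G"
proof (induction rule: cograph.induct)
  case (vertex v)
  then show ?case by (simp add: simple_graph_iff)
next
  case (union G H)
  have "\<exists>u\<in>verts G \<union> verts H. \<exists>v\<in>verts G \<union> verts H. u \<noteq> v \<and> e = {u, v}"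
    if "e \<in> edges G \<union> edges H" for e
    using that
  proof
    assume "e \<in> edges G"
    then show ?thesis using union.IH(1) unfolding simple_graph_iff by blast
  next
    assume "e \<in> edges H"
    then show ?thesis using union.IH(2) unfolding simple_graph_iff by blast
  qed
  moreover have "finite (verts G \<union> verts H)" using union.IH by (simp add: simple_graph_def)
  ultimately show ?case by (simp add: simple_graph_iff disjoint_union_def)
next
  case (join G H)
  have "\<exists>u\<in>verts G \<union> verts H. \<exists>v\<in>verts G \<union> verts H. u \<noteq> v \<and> e = {u, v}"
    if "e \<in> edges (join G H)" for e
  proof -
    from that consider "e \<in> edges G" | "e \<in> edges H"
      | v w where "v \<in> verts G" "w \<in> verts H" "e = {v, w}"
      by (auto simp: join_def)
    then show ?thesis
    proof cases
      case 1
      then show ?thesis using join.IH(1) unfolding simple_graph_iff by blast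
    next
      case 2
      then show ?thesis using join.IH(2) unfolding simple_graph_iff by blast
    next
      case 3
      then have "v \<noteq> w" using join.hyps by blast
      then show ?thesis using 3 by blast
    qed
  qed
  moreover have "finite (verts G \<union> verts H)" using join.IH by (simp add: simple_graph_def)
  ultimately show ?case by (simp add: simple_graph_iff join_def)
qed

lemma binary_cotree_num_nodes:
  "binary_cotree t G \<Longrightarrow> finite (verts G) \<and> num_nodes t + 1 = 2 * card (verts G)"
  by (induction rule: binary_cotree.induct)
     (auto simp: disjoint_union_def join_def card_Un_disjoint)


section \<open>Tree-clique width\<close>

definition vcc :: "'v graph \<Rightarrow> 'v set \<Rightarrow> nat" where
  "vcc G X = (LEAST k. \<exists>C. finite C \<and> (\<forall>K\<in>C. is_clique G K) \<and> \<Union>C = X \<and> card C = k)"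

text \<open>
  Decomposition trees are finite, so taking their nodes to be natural numbers loses no
  generality; it allows quantification over all decompositions inside a formula.
\<close>

definition tree_decomposition :: "'v graph \<Rightarrow> nat graph \<Rightarrow> (nat \<Rightarrow> 'v set) \<Rightarrow> bool" where
  "tree_decomposition G T X \<longleftrightarrow>
     is_tree T \<and>
     (\<forall>t\<in>verts T. X t \<subseteq> verts G) \<and>
     (\<forall>v\<in>verts G. \<exists>t\<in>verts T. v \<in> X t) \<and>
     (\<forall>e\<in>edges G. \<exists>t\<in>verts T. e \<subseteq> X t) \<and>
     (\<forall>v\<in>verts G. connected_graph (induced T {t. v \<in> X t}))"

definition augmented_tree_decomposition ::
    "'v graph \<Rightarrow> nat graph \<Rightarrow> (nat \<Rightarrow> 'v set) \<Rightarrow> (nat \<Rightarrow> 'v set set) \<Rightarrow> bool" where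
  "augmented_tree_decomposition G T X C \<longleftrightarrow>
     tree_decomposition G T X \<and>
     (\<forall>t\<in>verts T. (\<forall>K\<in>C t. is_clique G K) \<and> \<Union>(C t) = X t)"

definition width :: "nat graph \<Rightarrow> (nat \<Rightarrow> 'v set set) \<Rightarrow> nat" where
  "width T C = Max ((\<lambda>t. card (C t)) ` verts T)"

definition tcl :: "'v graph \<Rightarrow> nat" where
  "tcl G = (LEAST k. \<exists>T X C. augmented_tree_decomposition G T X C \<and> width T C = k)"

lemma finite_cliques: "finite (verts G) \<Longrightarrow> \<forall>K\<in>C. is_clique G K \<Longrightarrow> finite C"
  by (rule finite_subset[of _ "Pow (verts G)"]) (auto simp: is_clique_def)

lemma vcc_attained:
  assumes "finite (verts G)" "X \<subseteq> verts G"
  obtains C where "\<forall>K\<in>C. is_clique G K" "\<Union>C = X" "card C = vcc G X"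
proof -
  let ?P = "\<lambda>k. \<exists>C. finite C \<and> (\<forall>K\<in>C. is_clique G K) \<and> \<Union>C = X \<and> card C = k"
  have "?P (card ((\<lambda>v. {v}) ` X))"
    using assms
    by (intro exI[of _ "(\<lambda>v. {v}) ` X"])
       (auto simp: is_clique_def clique_def intro: finite_subset)
  then have "?P (vcc G X)"
    unfolding vcc_def by (rule LeastI)
  then show thesis using that by blast
qed

lemma vcc_le:
  assumes "finite (verts G)" "\<forall>K\<in>C. is_clique G K"
  shows "vcc G (\<Union>C) \<le> card C"
  unfolding vcc_def using finite_cliques[OF assms] assms(2)
  by (intro Least_le) auto

lemma tcl_eq_min_max_vcc:
  assumes fin: "finite (verts G)"
  shows "tcl G =
    (LEAST k. \<exists>T X. tree_decomposition G T X \<and> Max ((\<lambda>t. vcc G (X t)) ` verts T) = k)"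
proof -
  let ?A = "\<lambda>k. \<exists>T X C. augmented_tree_decomposition G T X C \<and> width T C = k"
  let ?B = "\<lambda>k. \<exists>T X. tree_decomposition G T X \<and> Max ((\<lambda>t. vcc G (X t)) ` verts T) = k"
  have tree: "finite (verts T) \<and> verts T \<noteq> {}" if "tree_decomposition G T X" for T X
    using that
    by (auto simp: tree_decomposition_def is_tree_def simple_graph_def connected_graph_def)
  have AB: "\<exists>j\<le>k. ?B j" if "?A k" for k
  proof -
    from that obtain T X C where
      a: "augmented_tree_decomposition G T X C" and w: "width T C = k" by blast
    have td: "tree_decomposition G T X" using a by (simp add: augmented_tree_decomposition_def)
    have "vcc G (X t) \<le> card (C t)" if "t \<in> verts T" for t
      using vcc_le[OF fin, of "C t"] a that by (auto simp: augmented_tree_decomposition_def)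
    then have "Max ((\<lambda>t. vcc G (X t)) ` verts T) \<le> k"
      using tree[OF td] unfolding w[symmetric] width_def
      by (subst Max_le_iff) (auto intro!: Max_ge_iff[THEN iffD2])
    then show ?thesis using td by blast
  qed
  have BA: "?A k" if "?B k" for k
  proof -
    from that obtain T X where
      td: "tree_decomposition G T X" and k: "Max ((\<lambda>t. vcc G (X t)) ` verts T) = k" by blast
    have "\<forall>t\<in>verts T. \<exists>C. (\<forall>K\<in>C. is_clique G K) \<and> \<Union>C = X t \<and> card C = vcc G (X t)"
    proof
      fix t assume "t \<in> verts T"
      then have "X t \<subseteq> verts G" using td by (simp add: tree_decomposition_def)
      from vcc_attained[OF fin this]
      show "\<exists>C. (\<forall>K\<in>C. is_clique G K) \<and> \<Union>C = X t \<and> card C = vcc G (X t)"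
        by metis
    qed
    from bchoice[OF this] obtain C where C: "\<forall>t\<in>verts T.
        (\<forall>K\<in>C t. is_clique G K) \<and> \<Union>(C t) = X t \<and> card (C t) = vcc G (X t)" ..
    have "width T C = k"
      unfolding width_def k[symmetric] using C by (intro arg_cong[of _ _ Max] image_cong) auto
    moreover have "augmented_tree_decomposition G T X C"
      using td C by (simp add: augmented_tree_decomposition_def)
    ultimately show ?thesis by blast
  qed
  have "Least ?A = Least ?B"
  proof (cases "\<exists>k. ?A k")
    case True
    then have A: "?A (Least ?A)" by (rule LeastI_ex)
    from AB[OF A] obtain j where j: "j \<le> Least ?A" "?B j" by blast
    have B: "?B (Least ?B)" using j(2) by (rule LeastI)
    have "Least ?B \<le> Least ?A" using Least_le[of ?B j, OF j(2)] j(1) by linarith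
    moreover have "Least ?A \<le> Least ?B" using BA[OF B] by (rule Least_le)
    ultimately show ?thesis by linarith
  next
    case False
    then have "?A = ?B" using BA by blast
    then show ?thesis by simp
  qed
  then show ?thesis by (simp add: tcl_def)
qed


section \<open>Word RAM\<close>

text \<open>
  A word RAM with word length \<open>w\<close>: registers and memory cells hold words, that is, numbers below
  \<open>2 ^ w\<close>, and arithmetic is modulo \<open>2 ^ w\<close>. Each instruction costs one unit of time. The machine
  halts as soon as the program counter is outside the program. A program mentions only finitely
  many registers; the memory is accessed indirectly, at the address held in a register.
\<close>

type_synonym reg = nat

datatype instr =
    Const reg nat     \<comment> \<open>\<open>r := k\<close>\<close>
  | Add reg reg reg   \<comment> \<open>\<open>r := a + b\<close>\<close>
  | Sub reg reg reg   \<comment> \<open>\<open>r := a - b\<close>\<close>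
  | Load reg reg      \<comment> \<open>\<open>r := mem[a]\<close>\<close>
  | Store reg reg     \<comment> \<open>\<open>mem[a] := r\<close>, with the address register \<open>a\<close> first\<close>
  | Jless reg reg nat \<comment> \<open>if \<open>a < b\<close> then go to the given instruction\<close>
  | Jump nat

record state =
  pc :: nat
  regs :: "reg \<Rightarrow> nat"
  mem :: "nat \<Rightarrow> nat"

fun exec_instr :: "nat \<Rightarrow> instr \<Rightarrow> state \<Rightarrow> state" where
  "exec_instr w (Const r k) s =
     s\<lparr>pc := pc s + 1, regs := (regs s)(r := k mod 2 ^ w)\<rparr>"
| "exec_instr w (Add r a b) s =
     s\<lparr>pc := pc s + 1, regs := (regs s)(r := (regs s a + regs s b) mod 2 ^ w)\<rparr>"
| "exec_instr w (Sub r a b) s =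
     s\<lparr>pc := pc s + 1, regs := (regs s)(r := (regs s a + 2 ^ w - regs s b) mod 2 ^ w)\<rparr>"
| "exec_instr w (Load r a) s =
     s\<lparr>pc := pc s + 1, regs := (regs s)(r := mem s (regs s a))\<rparr>"
| "exec_instr w (Store a r) s =
     s\<lparr>pc := pc s + 1, mem := (mem s)(regs s a := regs s r)\<rparr>"
| "exec_instr w (Jless a b l) s =
     s\<lparr>pc := (if regs s a < regs s b then l else pc s + 1)\<rparr>"
| "exec_instr w (Jump l) s = s\<lparr>pc := l\<rparr>"

definition halted :: "instr list \<Rightarrow> state \<Rightarrow> bool" where
  "halted P s \<longleftrightarrow> length P \<le> pc s"

definition step :: "nat \<Rightarrow> instr list \<Rightarrow> state \<Rightarrow> state" where
  "step w P s = (if halted P s then s else exec_instr w (P ! pc s) s)"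

text \<open>The input is a list of words, stored from address 0 on; its length is in register 0.\<close>

definition init_state :: "nat list \<Rightarrow> state" where
  "init_state xs =
     \<lparr>pc = 0, regs = (\<lambda>_. 0)(0 := length xs), mem = (\<lambda>i. if i < length xs then xs ! i else 0)\<rparr>"

text \<open>The result is read off register 0 after halting.\<close>

definition computes_within :: "nat \<Rightarrow> instr list \<Rightarrow> nat list \<Rightarrow> nat \<Rightarrow> nat \<Rightarrow> bool" where
  "computes_within w P xs y k \<longleftrightarrow>
     (let s = (step w P ^^ k) (init_state xs) in halted P s \<and> regs s 0 = y)"


section \<open>Cotrees as machine input\<close>

text \<open>
  The usual pointer representation. The nodes of the cotree are numbered from 0, in an arbitrary
  order. Word 0 of the input is the number of the root; node \<open>i\<close> occupies the three words from
  position \<open>3 * i + 1\<close> on: its label 0 or 1 followed by the numbers of its two children, or 2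
  followed by the name of the vertex (and an unused word) for a leaf.
\<close>

fun node_at :: "nat list \<Rightarrow> nat \<Rightarrow> nat cotree \<Rightarrow> bool" where
  "node_at xs i (Leaf v) \<longleftrightarrow>
     3 * i + 3 < length xs \<and> xs ! (3 * i + 1) = 2 \<and> xs ! (3 * i + 2) = v"
| "node_at xs i (Node0 l r) \<longleftrightarrow>
     3 * i + 3 < length xs \<and> xs ! (3 * i + 1) = 0 \<and>
     node_at xs (xs ! (3 * i + 2)) l \<and> node_at xs (xs ! (3 * i + 3)) r"
| "node_at xs i (Node1 l r) \<longleftrightarrow>
     3 * i + 3 < length xs \<and> xs ! (3 * i + 1) = 1 \<and>
     node_at xs (xs ! (3 * i + 2)) l \<and> node_at xs (xs ! (3 * i + 3)) r"

definition represents_cotree :: "nat list \<Rightarrow> nat cotree \<Rightarrow> bool" where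
  "represents_cotree xs t \<longleftrightarrow> length xs = 3 * num_nodes t + 1 \<and> node_at xs (xs ! 0) t"

end

(*
  Write vcc(G) for vcc(V(G)). Along a cotree, both parameters are computed from the children:
    vcc(G + H) = vcc(G) + vcc(H),        tcl(G + H) = max(tcl(G), tcl(H)),
    vcc(G * H) = max(vcc(G), vcc(H)),    tcl(G * H) = max(tcl(G), tcl(H), min(vcc(G), vcc(H))),
  where + is the disjoint union and * the join. For the last equation, in every tree decomposition
  of G * H some bag contains all of V(G) or all of V(H); conversely, all of V(H) can be added to
  every bag of a decomposition of G, since cliques of G and of H merge pairwise in the join.
  The program evaluates the two values by a traversal with an explicit stack behind the input.
*)
theory Submission
  imports Defs
begin

section \<open>Trees\<close>

text \<open>The recursion for tcl does not close on its own: a join needs vcc of both operands, so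
  the pair of parameters is carried along. Trees are given as connected acyclic graphs, which offer
  no recursion, so the groundwork is an induction principle that builds a tree by attaching leaves.
  Relabelling, gluing and the bag lemma for joins all follow from it. The other lower bounds come
  from passing to induced subgraphs, by cutting every bag down.

  On the machine side the obstacle is wrap-around modulo 2 ^ w. A cotree with N nodes takes 3N + 1
  input words and at most 3N stack words, and both parameters are at most N. So every address and
  value is linear in N = 2n - 1, which yields the factor 18 in the word-length condition. An
  internal node costs at most 44 steps of its own: 12 to push its frame, 13 to switch to the right
  child, 12 to pop and 7 to combine.\<close>

definition adj :: "'v graph \<Rightarrow> ('v \<times> 'v) set" where
  "adj G = {(x, y). {x, y} \<in> edges G}"

definition add_leaf :: "'v graph \<Rightarrow> 'v \<Rightarrow> 'v \<Rightarrow> 'v graph" where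
  "add_leaf T l p = (insert l (verts T), insert {l, p} (edges T))"

lemma verts_add_leaf [simp]: "verts (add_leaf T l p) = insert l (verts T)"
  and edges_add_leaf [simp]: "edges (add_leaf T l p) = insert {l, p} (edges T)"
  by (simp_all add: add_leaf_def)

lemma connected_graph_adj:
  "connected_graph G \<longleftrightarrow>
     verts G \<noteq> {} \<and> (\<forall>u\<in>verts G. \<forall>v\<in>verts G. (u, v) \<in> (adj G)\<^sup>*)"
  by (simp add: connected_graph_def adj_def)

lemma simple_graph_edge:
  assumes "simple_graph G" "{x, y} \<in> edges G"
  shows "x \<in> verts G" "y \<in> verts G" "x \<noteq> y"
proof -
  obtain u v where "u \<in> verts G" "v \<in> verts G" "u \<noteq> v" "{x, y} = {u, v}"
    using assms unfolding simple_graph_iff by blast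
  then show "x \<in> verts G" "y \<in> verts G" "x \<noteq> y" by (auto simp: doubleton_eq_iff)
qed

lemma simple_graph_edgeE:
  assumes "simple_graph G" "e \<in> edges G" "x \<in> e"
  obtains y where "e = {x, y}"
proof -
  obtain u v where "e = {u, v}" using assms(1,2) unfolding simple_graph_iff by blast
  then show thesis using assms(3) that[of u] that[of v] by auto
qed

lemma simple_graph_edge_subset: "simple_graph G \<Longrightarrow> e \<in> edges G \<Longrightarrow> e \<subseteq> verts G"
  by (metis simple_graph_edgeE simple_graph_edge(1) subsetI)

lemma simple_graph_induced:
  assumes "simple_graph G"
  shows "simple_graph (induced G S)"
  unfolding simple_graph_iff
proof (intro conjI ballI)
  show "finite (verts (induced G S))" using assms by (simp add: simple_graph_iff induced_def)
  fix e assume "e \<in> edges (induced G S)"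
  then have e: "e \<in> edges G" "e \<subseteq> S" by (auto simp: induced_def)
  then obtain u v where "u \<in> verts G" "v \<in> verts G" "u \<noteq> v" "e = {u, v}"
    using assms unfolding simple_graph_iff by blast
  then show "\<exists>u\<in>verts (induced G S). \<exists>v\<in>verts (induced G S). u \<noteq> v \<and> e = {u, v}"
    using e(2) by (intro bexI[of _ u] bexI[of _ v]) (auto simp: induced_def)
qed

section \<open>Attaching and removing a leaf\<close>

lemma connected_graph_add_leaf:
  assumes "connected_graph T" "p \<in> verts T"
  shows "connected_graph (add_leaf T l p)"
proof -
  let ?R = "(adj (add_leaf T l p))\<^sup>*"
  have old: "(u, v) \<in> ?R" if "u \<in> verts T" "v \<in> verts T" for u v
  proof -
    have "(u, v) \<in> (adj T)\<^sup>*" using assms(1) that by (simp add: connected_graph_adj)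
    then show ?thesis by (rule rev_subsetD) (intro rtrancl_mono, auto simp: adj_def)
  qed
  have "(l, p) \<in> ?R" "(p, l) \<in> ?R"
    by (auto simp: adj_def insert_commute intro!: r_into_rtrancl)
  then show ?thesis
    using old assms(2) by (auto simp: connected_graph_adj intro: rtrancl_trans)
qed

text \<open>Retracting the leaf onto its neighbour maps walks to walks.\<close>

lemma connected_graph_remove_leaf:
  assumes "connected_graph (add_leaf T l p)" "simple_graph T" "l \<notin> verts T" "p \<in> verts T"
  shows "connected_graph T"
proof -
  define f where "f x = (if x = l then p else x)" for x
  have "(f u, f v) \<in> (adj T)\<^sup>*" if "(u, v) \<in> (adj (add_leaf T l p))\<^sup>*" for u v
    using that
  proof (induction rule: rtrancl_induct)
    case (step y z)
    from step.hyps(2) consider "{y, z} = {l, p}" | "{y, z} \<in> edges T"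
      by (auto simp: adj_def)
    then have "f y = f z \<or> (f y, f z) \<in> adj T"
    proof cases
      case 1
      then show ?thesis by (auto simp: f_def doubleton_eq_iff)
    next
      case 2
      then show ?thesis
        using simple_graph_edge[OF assms(2) 2] assms(3) by (auto simp: f_def adj_def)
    qed
    then show ?case using step.IH by (auto intro: rtrancl_into_rtrancl)
  qed simp
  moreover have "f u = u" if "u \<in> verts T" for u using that assms(3) by (auto simp: f_def)
  ultimately show ?thesis
    using assms(1,4) unfolding connected_graph_adj by (metis empty_iff insertCI verts_add_leaf)
qed

text \<open>Cycles have length at least 3, so the predecessor and the successor of a vertex on one
  differ. This keeps a leaf, with its single neighbour, off every cycle.\<close>

lemma is_cycle_neighbours:
  assumes "is_cycle G c" "x \<in> set c"
  obtains y z where "{x, y} \<in> edges G" "{x, z} \<in> edges G" "y \<noteq> z"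
proof -
  let ?n = "length c"
  have c: "3 \<le> ?n" "distinct c" "\<And>i. i < ?n \<Longrightarrow> {c ! i, c ! (Suc i mod ?n)} \<in> edges G"
    using assms(1) by (auto simp: is_cycle_def)
  obtain i where i: "i < ?n" "x = c ! i" using assms(2) by (metis in_set_conv_nth)
  \<comment> \<open>\<open>j\<close> is the cyclic predecessor of \<open>i\<close>; index 0 wraps
    around to the last one.\<close>
  define j where "j = (if i = 0 then ?n - 1 else i - 1)"
  have j: "j < ?n" "Suc j mod ?n = i" using i(1) c(1) by (auto simp: j_def)
  have s: "Suc i mod ?n < ?n" using c(1) by (intro mod_less_divisor) linarith
  have "Suc i mod ?n \<noteq> j"
    using i(1) c(1) by (cases "Suc i = ?n") (auto simp: j_def)
  then have "c ! (Suc i mod ?n) \<noteq> c ! j"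
    using c(2) s j(1) by (simp add: nth_eq_iff_index_eq)
  moreover have "{x, c ! (Suc i mod ?n)} \<in> edges G" using c(3)[OF i(1)] i(2) by simp
  moreover have "{x, c ! j} \<in> edges G"
    using c(3)[OF j(1)] unfolding j(2) i(2) by (simp add: insert_commute)
  ultimately show thesis using that by blast
qed

lemma is_tree_singleton: "is_tree ({v}, {})"
proof -
  have "\<not> is_cycle ({v}, {}) c" for c :: "'a list"
    by (cases c) (auto simp: is_cycle_def)
  then show ?thesis by (auto simp: is_tree_def simple_graph_iff connected_graph_def)
qed

lemma is_tree_add_leaf:
  assumes "is_tree T" "p \<in> verts T" "l \<notin> verts T"
  shows "is_tree (add_leaf T l p)"
proof -
  have T: "simple_graph T" "connected_graph T" "\<nexists>c. is_cycle T c"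
    using assms(1) by (auto simp: is_tree_def)
  have "simple_graph (add_leaf T l p)"
    using T(1) assms(2,3) unfolding simple_graph_iff
    by (metis edges_add_leaf finite_insert insert_iff verts_add_leaf)
  moreover have "\<not> is_cycle (add_leaf T l p) c" for c
  proof
    assume c: "is_cycle (add_leaf T l p) c"
    have nbr: "y = p" if "{l, y} \<in> edges (add_leaf T l p)" for y
      using that simple_graph_edge[OF T(1), of l y] assms(2,3) by (auto simp: doubleton_eq_iff)
    have "l \<notin> set c"
    proof
      assume "l \<in> set c"
      from is_cycle_neighbours[OF c this] show False using nbr by metis
    qed
    then have "c ! i \<noteq> l" if "i < length c" for i using that by (metis nth_mem)
    then have "{c ! i, c ! (Suc i mod length c)} \<in> edges T" if "i < length c" for i
      using c that unfolding is_cycle_def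
      by (metis doubleton_eq_iff edges_add_leaf gr_implies_not0 insert_iff mod_less_divisor
          not_gr_zero)
    then have "is_cycle T c" using c by (simp add: is_cycle_def)
    then show False using T(3) by blast
  qed
  ultimately show ?thesis
    using connected_graph_add_leaf[OF T(2) assms(2)] by (simp add: is_tree_def)
qed

section \<open>Existence of leaves and induction over trees\<close>

definition is_path :: "'v graph \<Rightarrow> 'v list \<Rightarrow> bool" where
  "is_path G p \<longleftrightarrow> distinct p \<and> set p \<subseteq> verts G \<and>
     (\<forall>i. Suc i < length p \<longrightarrow> {p ! i, p ! Suc i} \<in> edges G)"

text \<open>The leaf is an end of a longest path.\<close>

lemma is_tree_leaf:
  assumes T: "is_tree T" and card: "1 < card (verts T)"
  obtains l p where "{l, p} \<in> edges T" "\<And>x. {l, x} \<in> edges T \<Longrightarrow> x = p"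
proof -
  have simple: "simple_graph T" and conn: "connected_graph T" and acyc: "\<nexists>c. is_cycle T c"
    using T by (auto simp: is_tree_def)
  have fin: "finite (verts T)" using simple by (simp add: simple_graph_iff)
  obtain u v where uv: "u \<in> verts T" "v \<in> verts T" "u \<noteq> v"
    using card by (metis One_nat_def card_le_Suc0_iff_eq fin leD)
  have "(u, v) \<in> (adj T)\<^sup>*" using conn uv by (simp add: connected_graph_adj)
  then obtain y where "{u, y} \<in> edges T"
    using uv(3) by (cases rule: converse_rtranclE) (auto simp: adj_def)
  then have path2: "is_path T [u, y]"
    using simple_graph_edge[OF simple, of u y] by (auto simp: is_path_def less_Suc_eq)
  \<comment> \<open>Paths have distinct vertices, so their lengths are bounded and a longest one
    exists; the path \<open>[u, y]\<close> shows that it has at least two vertices.\<close>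
  have "length p \<le> card (verts T)" if "is_path T p" for p
    using that card_mono[OF fin, of "set p"] by (simp add: is_path_def distinct_card)
  then obtain p where p: "is_path T p" "\<And>q. is_path T q \<Longrightarrow> length q \<le> length p"
    using ex_has_greatest_nat[of "is_path T" "[u, y]" length "Suc (card (verts T))"] path2
    by (auto simp: less_Suc_eq_le)
  have len: "2 \<le> length p" using p(2)[OF path2] by simp
  have dist: "distinct p" and sub: "set p \<subseteq> verts T"
    and ed: "\<And>i. Suc i < length p \<Longrightarrow> {p ! i, p ! Suc i} \<in> edges T"
    using p(1) by (auto simp: is_path_def)
  show thesis
  proof (rule that[of "p ! 0" "p ! 1"])
    show "{p ! 0, p ! 1} \<in> edges T" using ed[of 0] len by simp
  next
    fix x assume x: "{p ! 0, x} \<in> edges T"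
    note x' = simple_graph_edge[OF simple x]
    have "x \<in> set p"
    proof (rule ccontr)
      assume "x \<notin> set p"
      have "{(x # p) ! i, (x # p) ! Suc i} \<in> edges T" if "Suc i < length (x # p)" for i
        using that x ed by (cases i) (auto simp: insert_commute)
      then have "is_path T (x # p)"
        using \<open>x \<notin> set p\<close> dist sub x'(2) unfolding is_path_def by simp
      from p(2)[OF this] show False by simp
    qed
    then obtain j where j: "j < length p" "x = p ! j" by (metis in_set_conv_nth)
    have "j \<noteq> 0" using x'(3) j(2) by (intro notI) simp
    moreover have "\<not> 2 \<le> j"
    proof
      assume "2 \<le> j"
      \<comment> \<open>The edge from \<open>p ! 0\<close> to \<open>p ! j\<close> closes this
        initial segment of the path to a cycle; \<open>2 \<le> j\<close> gives it the required three
        vertices.\<close>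
      let ?c = "take (Suc j) p"
      have lc: "length ?c = Suc j" using j(1) by simp
      have "{?c ! i, ?c ! (Suc i mod length ?c)} \<in> edges T" if "i < length ?c" for i
      proof (cases "i = j")
        case True
        then show ?thesis using x j(1,2) lc by (simp add: insert_commute)
      next
        case False
        then have "i < j" using that lc by simp
        then show ?thesis using ed[of i] j(1) lc by simp
      qed
      then have "is_cycle T ?c"
        using \<open>2 \<le> j\<close> lc dist unfolding is_cycle_def by simp
      then show False using acyc by blast
    qed
    ultimately have "j = 1" by linarith
    then show "x = p ! 1" using j(2) by simp
  qed
qed

lemma is_tree_cases:
  assumes "is_tree T"
  obtains (singleton) v where "T = ({v}, {})"
  | (leaf) T' l p where "T = add_leaf T' l p" "is_tree T'" "p \<in> verts T'" "l \<notin> verts T'"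
proof -
  have simple: "simple_graph T" and conn: "connected_graph T" and acyc: "\<nexists>c. is_cycle T c"
    using assms by (auto simp: is_tree_def)
  have fin: "finite (verts T)" using simple by (simp add: simple_graph_iff)
  have "verts T \<noteq> {}" using conn by (simp add: connected_graph_def)
  then consider "card (verts T) = 1" | "1 < card (verts T)"
    using fin by (metis One_nat_def card_0_eq less_one nat_neq_iff)
  then show thesis
  proof cases
    case 1
    then obtain v where v: "verts T = {v}" by (rule card_1_singletonE)
    then have "edges T = {}" using simple unfolding simple_graph_iff by auto
    then show thesis using v singleton by (metis prod.collapse)
  next
    case 2
    obtain l p where lp: "{l, p} \<in> edges T" "\<And>x. {l, x} \<in> edges T \<Longrightarrow> x = p"
      using is_tree_leaf[OF assms 2] by blast
    note lp' = simple_graph_edge[OF simple lp(1)]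
    define T' where "T' = induced T (- {l})"
    have T': "verts T' = verts T - {l}" "edges T' = {e \<in> edges T. l \<notin> e}"
      by (auto simp: T'_def induced_def)
    have "e = {l, p}" if e: "e \<in> edges T" "l \<in> e" for e
    proof -
      obtain x where "e = {l, x}" using simple_graph_edgeE[OF simple e] .
      then show ?thesis using lp(2)[of x] e(1) by simp
    qed
    then have "edges T = insert {l, p} (edges T')" using lp(1) T'(2) by blast
    moreover have "verts T = insert l (verts T')" using lp'(1) T'(1) by blast
    ultimately have eq: "T = add_leaf T' l p" by (simp add: add_leaf_def prod_eq_iff)
    have p: "p \<in> verts T'" "l \<notin> verts T'" using lp' T' by auto
    have simple': "simple_graph T'" unfolding T'_def using simple by (rule simple_graph_induced)
    have "connected_graph T'"
      using conn unfolding eq by (rule connected_graph_remove_leaf[OF _ simple' p(2,1)])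
    moreover have "\<not> is_cycle T' c" for c
      using acyc T'(2) unfolding is_cycle_def by blast
    ultimately have "is_tree T'" using simple' by (simp add: is_tree_def)
    then show thesis using eq p leaf by blast
  qed
qed

text \<open>Removing a leaf keeps a tree connected and acyclic, so every tree arises from a single
  node by attaching fresh leaves. All later arguments about trees recurse through this rule.\<close>

lemma is_tree_induct [consumes 1, case_names singleton leaf]:
  assumes "is_tree T"
    and single: "\<And>v. P ({v}, {})"
    and leaf: "\<And>T l p. is_tree T \<Longrightarrow> p \<in> verts T \<Longrightarrow> l \<notin> verts T \<Longrightarrow> P T \<Longrightarrow> P (add_leaf T l p)"
  shows "P T"
  using assms(1)
proof (induction "card (verts T)" arbitrary: T rule: less_induct)
  case less
  from less.prems show ?case
  proof (cases rule: is_tree_cases)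
    case (singleton v)
    then show ?thesis using single by simp
  next
    case (leaf T' l p)
    have "finite (verts T')" using leaf(2) by (simp add: is_tree_def simple_graph_iff)
    then have "card (verts T') < card (verts T)" using leaf(1,4) by simp
    then have "P T'" using less.hyps leaf(2) by blast
    then show ?thesis using leaf assms(3) by blast
  qed
qed

section \<open>Relabelling and gluing trees\<close>

definition map_graph :: "('u \<Rightarrow> 'v) \<Rightarrow> 'u graph \<Rightarrow> 'v graph" where
  "map_graph f G = (f ` verts G, (`) f ` edges G)"

lemma is_tree_map_graph:
  assumes "is_tree T" "inj f"
  shows "is_tree (map_graph f T)"
  using assms(1)
proof (induction rule: is_tree_induct)
  case (singleton v)
  then show ?case by (simp add: map_graph_def is_tree_singleton)
next
  case (leaf T l p)
  have "map_graph f (add_leaf T l p) = add_leaf (map_graph f T) (f l) (f p)"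
    by (simp add: map_graph_def add_leaf_def)
  moreover have "f l \<notin> verts (map_graph f T)" "f p \<in> verts (map_graph f T)"
    using leaf.hyps assms(2) by (auto simp: map_graph_def dest: injD)
  ultimately show ?case using is_tree_add_leaf[OF leaf.IH] by simp
qed

text \<open>The connecting edge arises when the first node of \<open>T2\<close> is attached to
  \<open>T1\<close> as a leaf; every further node of \<open>T2\<close> is again a leaf attached to
  what is already there.\<close>

lemma is_tree_glue:
  assumes "is_tree T2" "is_tree T1" "verts T1 \<inter> verts T2 = {}"
  shows "\<exists>a\<in>verts T1. \<exists>b\<in>verts T2.
    is_tree (verts T1 \<union> verts T2, insert {a, b} (edges T1 \<union> edges T2))"
  using assms(1,3)
proof (induction rule: is_tree_induct)
  case (singleton v)
  obtain a where a: "a \<in> verts T1"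
    using assms(2) by (auto simp: is_tree_def connected_graph_def)
  then have "is_tree (add_leaf T1 v a)"
    using is_tree_add_leaf[OF assms(2) a] singleton by simp
  then show ?case using a by (auto simp: add_leaf_def insert_commute)
next
  case (leaf T l p)
  then obtain a b where ab: "a \<in> verts T1" "b \<in> verts T"
    "is_tree (verts T1 \<union> verts T, insert {a, b} (edges T1 \<union> edges T))"
    by auto
  have "is_tree (add_leaf (verts T1 \<union> verts T, insert {a, b} (edges T1 \<union> edges T)) l p)"
    using leaf.hyps leaf.prems by (intro is_tree_add_leaf[OF ab(3)]) auto
  then show ?case using ab(1,2) by (auto simp: add_leaf_def insert_commute)
qed

text \<open>A walk inside \<open>S\<close> from \<open>l\<close> to a node of \<open>T\<close> must
  leave \<open>l\<close> by its only edge, so \<open>p\<close> lies in \<open>S\<close>. Hence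
  \<open>l\<close>, if present, is a leaf of the induced graph as well and can be removed from it.
  Applied to the set of nodes whose bags contain a fixed vertex.\<close>

lemma induced_add_leaf_connected:
  assumes conn: "connected_graph (induced (add_leaf T l p) S)"
    and T: "simple_graph T" "l \<notin> verts T" "p \<in> verts T" and ne: "verts T \<inter> S \<noteq> {}"
  shows "connected_graph (induced T S)" "l \<in> S \<Longrightarrow> p \<in> S"
proof -
  show p: "p \<in> S" if "l \<in> S"
  proof -
    obtain u where u: "u \<in> verts T" "u \<in> S" using ne by blast
    have "(l, u) \<in> (adj (induced (add_leaf T l p) S))\<^sup>*"
      using conn u that by (simp add: connected_graph_adj induced_def)
    moreover have "l \<noteq> u" using u(1) T(2) by blast
    ultimately obtain y where y: "{l, y} \<in> insert {l, p} (edges T)" "{l, y} \<subseteq> S"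
      by (cases rule: converse_rtranclE) (auto simp: adj_def induced_def)
    then have "y = p"
      using simple_graph_edge[OF T(1), of l y] T(2) by (auto simp: doubleton_eq_iff)
    then show ?thesis using y by simp
  qed
  show "connected_graph (induced T S)"
  proof (cases "l \<in> S")
    case True
    then have "induced (add_leaf T l p) S = add_leaf (induced T S) l p"
      using p by (auto simp: induced_def add_leaf_def)
    then show ?thesis
      using conn connected_graph_remove_leaf[of "induced T S" l p] simple_graph_induced[OF T(1)]
        p[OF True] T(2,3) by (simp add: induced_def)
  next
    case False
    then have "induced (add_leaf T l p) S = induced T S"
      by (auto simp: induced_def add_leaf_def)
    then show ?thesis using conn by simp
  qed
qed

section \<open>Complete bipartite subgraphs in tree decompositions\<close>

text \<open>
  If removing a leaf node loses a vertex of one side, then that vertex lies in the leaf's bag only,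
  so that bag contains the whole other side.
\<close>

lemma biclique_side_in_bag:
  assumes "is_tree T"
    and "\<forall>v\<in>A \<union> B. connected_graph (induced T {t. v \<in> X t})"
    and "\<forall>a\<in>A. \<forall>b\<in>B. \<exists>t\<in>verts T. a \<in> X t \<and> b \<in> X t"
  shows "\<exists>t\<in>verts T. A \<subseteq> X t \<or> B \<subseteq> X t"
  using assms
proof (induction rule: is_tree_induct)
  case (singleton s)
  \<comment> \<open>Connectedness includes non-emptiness, so each vertex of both sides lies in the
    only bag.\<close>
  then show ?case by (auto simp: connected_graph_def induced_def)
next
  case (leaf T l p)
  have simple: "simple_graph T" using leaf.hyps(1) by (simp add: is_tree_def)
  show ?case
  proof (cases "\<exists>v\<in>A \<union> B. verts T \<inter> {t. v \<in> X t} = {}")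
    case True
    then obtain v where v: "v \<in> A \<union> B" "\<forall>t\<in>verts T. v \<notin> X t" by blast
    then have "A \<subseteq> X l \<or> B \<subseteq> X l" using leaf.prems(2) by fastforce
    then show ?thesis by simp
  next
    case False
    note sub = induced_add_leaf_connected[OF leaf.prems(1)[rule_format] simple leaf.hyps(3,2)]
    have c: "\<forall>v\<in>A \<union> B. connected_graph (induced T {t. v \<in> X t})"
      using sub(1) False by blast
    \<comment> \<open>Every vertex of either side in the leaf's bag recurs in the bag of its
      neighbour \<open>p\<close>, so each pair that met at \<open>l\<close> also meets at
      \<open>p\<close> and deleting \<open>l\<close> loses no pair.\<close>
    have p: "v \<in> X p" if "v \<in> A \<union> B" "v \<in> X l" for v
      using sub(2)[OF that(1)] False that by blast
    have "\<forall>a\<in>A. \<forall>b\<in>B. \<exists>t\<in>verts T. a \<in> X t \<and> b \<in> X t"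
    proof (intro ballI)
      fix a b assume ab: "a \<in> A" "b \<in> B"
      then obtain t where "t = l \<or> t \<in> verts T" "a \<in> X t" "b \<in> X t"
        using leaf.prems(2) by auto
      then show "\<exists>t\<in>verts T. a \<in> X t \<and> b \<in> X t"
        using p ab leaf.hyps(2) by blast
    qed
    then show ?thesis using leaf.IH[OF c] by auto
  qed
qed

section \<open>Clique covers\<close>

text \<open>Passing from a set of cliques to a family indexed by \<open>i < k\<close> lets the
  cliques of two graphs be matched index by index, and allows repetitions and empty members.\<close>

lemma vcc_le_iff:
  assumes "finite (verts G)" "X \<subseteq> verts G"
  shows "vcc G X \<le> k \<longleftrightarrow> (\<exists>f. (\<forall>i<k. is_clique G (f i)) \<and> (\<Union>i<k. f i) = X)"
proof
  assume le: "vcc G X \<le> k"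
  obtain C where C: "\<forall>K\<in>C. is_clique G K" "\<Union>C = X" "card C = vcc G X"
    using vcc_attained[OF assms] .
  have "finite C" by (rule finite_cliques[OF assms(1) C(1)])
  then obtain h where h: "bij_betw h {0..<card C} C" using ex_bij_betw_nat_finite by blast
  \<comment> \<open>A minimum cover is padded to length \<open>k\<close> with the empty set, which
    is a clique.\<close>
  define f where "f i = (if i < card C then h i else {})" for i
  have h_in: "h i \<in> C" if "i < card C" for i using bij_betwE[OF h] that by simp
  have "is_clique G (f i)" for i
  proof (cases "i < card C")
    case True
    then show ?thesis using C(1) h_in by (simp add: f_def)
  next
    case False
    then show ?thesis by (simp add: f_def is_clique_def clique_def)
  qed
  moreover have "(\<Union>i<k. f i) = (\<Union>i<card C. h i)"
  proof
    show "(\<Union>i<k. f i) \<subseteq> (\<Union>i<card C. h i)" by (auto simp: f_def split: if_splits)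
    have "i < k" if "i < card C" for i using that le C(3) by linarith
    then show "(\<Union>i<card C. h i) \<subseteq> (\<Union>i<k. f i)" by (fastforce simp: f_def)
  qed
  moreover have "(\<Union>i<card C. h i) = X"
    using h C(2) by (simp add: bij_betw_def lessThan_atLeast0)
  ultimately show "\<exists>f. (\<forall>i<k. is_clique G (f i)) \<and> (\<Union>i<k. f i) = X"
    by (intro exI[of _ f]) simp
next
  assume "\<exists>f. (\<forall>i<k. is_clique G (f i)) \<and> (\<Union>i<k. f i) = X"
  then obtain f where f: "\<forall>i<k. is_clique G (f i)" "(\<Union>i<k. f i) = X" by blast
  have "vcc G (\<Union>(f ` {..<k})) \<le> card (f ` {..<k})"
    using f(1) by (intro vcc_le[OF assms(1)]) auto
  then show "vcc G X \<le> k" using f(2) card_image_le[of "{..<k}" f] by simp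
qed

lemma vcc_mono:
  assumes "finite (verts G)" "X \<subseteq> Y" "Y \<subseteq> verts G"
  shows "vcc G X \<le> vcc G Y"
proof -
  obtain f where f: "\<forall>i<vcc G Y. is_clique G (f i)" "(\<Union>i<vcc G Y. f i) = Y"
    using vcc_le_iff[OF assms(1,3), of "vcc G Y"] by auto
  have "\<forall>i<vcc G Y. is_clique G (f i \<inter> X)"
    using f(1) by (auto simp: is_clique_def clique_def)
  moreover have "(\<Union>i<vcc G Y. f i \<inter> X) = X" using f(2) assms(2) by auto
  moreover have "X \<subseteq> verts G" using assms(2,3) by (rule subset_trans)
  ultimately show ?thesis
    unfolding vcc_le_iff[OF assms(1) \<open>X \<subseteq> verts G\<close>] by (intro exI[of _ "\<lambda>i. f i \<inter> X"] conjI)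
qed

lemma is_clique_induced: "is_clique (induced G S) K \<longleftrightarrow> is_clique G K \<and> K \<subseteq> S"
  by (auto simp: is_clique_def clique_def induced_def)

text \<open>All cliques in a cover of \<open>X\<close> lie within \<open>X\<close>, hence within
  \<open>S\<close>, where both graphs have the same edges. This lets vcc of an operand be read
  inside the union or join.\<close>

lemma vcc_induced:
  assumes "X \<subseteq> S"
  shows "vcc (induced G S) X = vcc G X"
proof -
  have "(finite C \<and> (\<forall>K\<in>C. is_clique (induced G S) K) \<and> \<Union>C = X \<and> card C = k) \<longleftrightarrow>
      (finite C \<and> (\<forall>K\<in>C. is_clique G K) \<and> \<Union>C = X \<and> card C = k)" for C k
    using assms by (auto simp: is_clique_induced)
  then show ?thesis unfolding vcc_def by simp
qed

section \<open>Unions and joins: structure and clique covers\<close>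

lemma disjoint_union_commute: "disjoint_union G H = disjoint_union H G"
  by (auto simp: disjoint_union_def)

lemma join_commute: "join G H = join H G"
proof -
  define X where "X A B = {{v, w} | v w. v \<in> A \<and> w \<in> B}" for A B :: "'a set"
  have sub: "X A B \<subseteq> X B A" for A B
  proof
    fix e assume "e \<in> X A B"
    then obtain v w where "v \<in> A" "w \<in> B" "e = {w, v}" unfolding X_def by blast
    then show "e \<in> X B A" unfolding X_def by blast
  qed
  have "X (verts G) (verts H) = X (verts H) (verts G)" by (rule antisym[OF sub sub])
  then show ?thesis
    unfolding join_def X_def[symmetric]
    by (simp only: Un_commute[of "verts G"] Un_commute[of "edges G"])
qed

lemma verts_disjoint_union [simp]: "verts (disjoint_union G H) = verts G \<union> verts H"
  and verts_join [simp]: "verts (join G H) = verts G \<union> verts H"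
  by (simp_all add: disjoint_union_def join_def)

lemma no_edge_in_disjoint:
  assumes "simple_graph H" "verts G \<inter> verts H = {}" "e \<in> edges H"
  shows "\<not> e \<subseteq> verts G"
proof
  assume "e \<subseteq> verts G"
  moreover have "e \<subseteq> verts H" using simple_graph_edge_subset[OF assms(1,3)] .
  moreover have "e \<noteq> {}" using assms(1,3) unfolding simple_graph_iff by blast
  ultimately show False using assms(2) by blast
qed

lemma induced_disjoint_union:
  assumes "simple_graph G" "simple_graph H" "verts G \<inter> verts H = {}"
  shows "induced (disjoint_union G H) (verts G) = G"
  using simple_graph_edge_subset[OF assms(1)] no_edge_in_disjoint[OF assms(2,3)]
  by (auto simp: induced_def disjoint_union_def prod_eq_iff)

lemma induced_join:
  assumes "simple_graph G" "simple_graph H" "verts G \<inter> verts H = {}"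
  shows "induced (join G H) (verts G) = G"
  using simple_graph_edge_subset[OF assms(1)] no_edge_in_disjoint[OF assms(2,3)] assms(3)
  by (auto simp: induced_def join_def prod_eq_iff)

lemma simple_graph_disjoint_union:
  assumes "simple_graph G" "simple_graph H"
  shows "simple_graph (disjoint_union G H)"
  unfolding simple_graph_iff
proof (intro conjI ballI)
  show "finite (verts (disjoint_union G H))" using assms(1,2) by (simp add: simple_graph_iff)
  fix e assume "e \<in> edges (disjoint_union G H)"
  then consider "e \<in> edges G" | "e \<in> edges H" by (auto simp: disjoint_union_def)
  then show "\<exists>u\<in>verts (disjoint_union G H). \<exists>v\<in>verts (disjoint_union G H). u \<noteq> v \<and> e = {u, v}"
  proof cases
    case 1
    then show ?thesis
      using assms(1) unfolding simple_graph_iff verts_disjoint_union by blast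
  next
    case 2
    then show ?thesis
      using assms(2) unfolding simple_graph_iff verts_disjoint_union by blast
  qed
qed

lemma simple_graph_join:
  assumes "simple_graph G" "simple_graph H" "verts G \<inter> verts H = {}"
  shows "simple_graph (join G H)"
  unfolding simple_graph_iff
proof (intro conjI ballI)
  show "finite (verts (join G H))" using assms(1,2) by (simp add: simple_graph_iff)
  fix e assume "e \<in> edges (join G H)"
  then consider "e \<in> edges (disjoint_union G H)"
    | v w where "v \<in> verts G" "w \<in> verts H" "e = {v, w}"
    by (auto simp: join_def disjoint_union_def)
  then show "\<exists>u\<in>verts (join G H). \<exists>v\<in>verts (join G H). u \<noteq> v \<and> e = {u, v}"
  proof cases
    case 1
    then show ?thesis
      using simple_graph_disjoint_union[OF assms(1,2)] unfolding simple_graph_iff by simp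
  next
    case 2
    then have "v \<noteq> w" using assms(3) by blast
    then show ?thesis using 2 by auto
  qed
qed

lemma is_clique_disjoint_union:
  assumes "simple_graph G" "simple_graph H" "verts G \<inter> verts H = {}"
    and K: "is_clique (disjoint_union G H) K"
  shows "K \<subseteq> verts G \<or> K \<subseteq> verts H"
proof (rule ccontr)
  assume "\<not> ?thesis"
  then obtain x y where xy: "x \<in> K" "x \<notin> verts G" "y \<in> K" "y \<notin> verts H" by blast
  then have v: "x \<in> verts H" "y \<in> verts G" using K by (auto simp: is_clique_def)
  then have "x \<noteq> y" using assms(3) by blast
  then have "{x, y} \<in> edges G \<union> edges H"
    using K xy by (simp add: is_clique_def clique_def disjoint_union_def)
  then show False
    using simple_graph_edge[OF assms(1), of x y] simple_graph_edge[OF assms(2), of x y] xy by blast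
qed

lemma vcc_disjoint_union:
  assumes "simple_graph G" "simple_graph H" "verts G \<inter> verts H = {}"
  shows "vcc (disjoint_union G H) (verts G \<union> verts H) = vcc G (verts G) + vcc H (verts H)"
proof (rule antisym)
  let ?U = "disjoint_union G H"
  have fin: "finite (verts G)" "finite (verts H)" "finite (verts ?U)"
    using assms(1,2) by (simp_all add: simple_graph_iff)
  have ind: "induced ?U (verts G) = G" "induced ?U (verts H) = H"
    using induced_disjoint_union[OF assms] induced_disjoint_union[OF assms(2,1)] assms(3)
    by (simp_all add: disjoint_union_commute[of G H] Int_commute)
  have clG: "is_clique G K \<longleftrightarrow> is_clique ?U K \<and> K \<subseteq> verts G" for K
    using is_clique_induced[of ?U "verts G" K] ind(1) by simp
  have clH: "is_clique H K \<longleftrightarrow> is_clique ?U K \<and> K \<subseteq> verts H" for K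
    using is_clique_induced[of ?U "verts H" K] ind(2) by simp
  show "vcc ?U (verts G \<union> verts H) \<le> vcc G (verts G) + vcc H (verts H)"
  proof -
    obtain C where C: "\<forall>K\<in>C. is_clique G K" "\<Union>C = verts G" "card C = vcc G (verts G)"
      using vcc_attained[OF fin(1) order_refl] .
    obtain D where D: "\<forall>K\<in>D. is_clique H K" "\<Union>D = verts H" "card D = vcc H (verts H)"
      using vcc_attained[OF fin(2) order_refl] .
    have "vcc ?U (\<Union>(C \<union> D)) \<le> card (C \<union> D)"
      using C(1) D(1) clG clH by (intro vcc_le[OF fin(3)]) blast
    also have "\<dots> \<le> card C + card D" by (rule card_Un_le)
    finally show ?thesis using C(2,3) D(2,3) by simp
  qed
  show "vcc G (verts G) + vcc H (verts H) \<le> vcc ?U (verts G \<union> verts H)"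
  proof -
    obtain C where C: "\<forall>K\<in>C. is_clique ?U K" "\<Union>C = verts G \<union> verts H"
      "card C = vcc ?U (verts G \<union> verts H)"
      using vcc_attained[OF fin(3), of "verts G \<union> verts H"] by auto
    have finC: "finite C" by (rule finite_cliques[OF fin(3) C(1)])
    \<comment> \<open>The empty set lies inside both vertex sets; leaving it out makes
      \<open>D\<close> and \<open>E\<close> disjoint, so that their sizes add up.\<close>
    define D E where "D = {K \<in> C. K \<subseteq> verts G \<and> K \<noteq> {}}"
      and "E = {K \<in> C. K \<subseteq> verts H \<and> K \<noteq> {}}"
    have side: "K \<subseteq> verts G \<or> K \<subseteq> verts H" if "K \<in> C" for K
      using is_clique_disjoint_union[OF assms] C(1) that by blast
    have "\<Union>D = verts G"
    proof
      show "verts G \<subseteq> \<Union>D"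
      proof
        fix x assume x: "x \<in> verts G"
        then obtain K where K: "K \<in> C" "x \<in> K" using C(2) by blast
        then have "K \<subseteq> verts G" using side x assms(3) by blast
        then show "x \<in> \<Union>D" using K by (auto simp: D_def)
      qed
    qed (auto simp: D_def)
    then have "vcc G (verts G) \<le> card D"
      using vcc_le[OF fin(1), of D] C(1) clG by (auto simp: D_def)
    moreover have "\<Union>E = verts H"
    proof
      show "verts H \<subseteq> \<Union>E"
      proof
        fix x assume x: "x \<in> verts H"
        then obtain K where K: "K \<in> C" "x \<in> K" using C(2) by blast
        then have "K \<subseteq> verts H" using side x assms(3) by blast
        then show "x \<in> \<Union>E" using K by (auto simp: E_def)
      qed
    qed (auto simp: E_def)
    then have "vcc H (verts H) \<le> card E"
      using vcc_le[OF fin(2), of E] C(1) clH by (auto simp: E_def)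
    moreover have "card D + card E = card (D \<union> E)"
      using finC assms(3) by (intro card_Un_disjoint[symmetric]) (auto simp: D_def E_def)
    moreover have "card (D \<union> E) \<le> card C"
      using finC by (intro card_mono) (auto simp: D_def E_def)
    ultimately show ?thesis using C(3) by linarith
  qed
qed

text \<open>The i-th clique of one cover and the i-th clique of the other together form a clique,
  since all cross edges are present; so the cost is a maximum, not a sum. Arbitrary \<open>X\<close>
  and \<open>Y\<close> are allowed because the lemma also serves for bags enlarged by a whole
  side.\<close>

lemma vcc_join_le:
  assumes "simple_graph G" "simple_graph H" "verts G \<inter> verts H = {}"
    and "X \<subseteq> verts G" "Y \<subseteq> verts H" "vcc G X \<le> k" "vcc H Y \<le> k"
  shows "vcc (join G H) (X \<union> Y) \<le> k"
proof -
  have fin: "finite (verts G)" "finite (verts H)" "finite (verts (join G H))"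
    using assms(1,2) by (simp_all add: simple_graph_iff)
  obtain f where f: "\<forall>i<k. is_clique G (f i)" "(\<Union>i<k. f i) = X"
    using assms(6) unfolding vcc_le_iff[OF fin(1) assms(4)] by (elim exE conjE)
  obtain g where g: "\<forall>i<k. is_clique H (g i)" "(\<Union>i<k. g i) = Y"
    using assms(7) unfolding vcc_le_iff[OF fin(2) assms(5)] by (elim exE conjE)
  have "is_clique (join G H) (f i \<union> g i)" if "i < k" for i
  proof -
    have sub: "f i \<subseteq> verts G" "g i \<subseteq> verts H"
      and e: "\<And>x y. x \<in> f i \<Longrightarrow> y \<in> f i \<Longrightarrow> x \<noteq> y \<Longrightarrow> {x, y} \<in> edges G"
        "\<And>x y. x \<in> g i \<Longrightarrow> y \<in> g i \<Longrightarrow> x \<noteq> y \<Longrightarrow> {x, y} \<in> edges H"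
      using f(1) g(1) that by (auto simp: is_clique_def clique_def)
    have cross: "{x, y} \<in> edges (join G H)" "{y, x} \<in> edges (join G H)"
      if "x \<in> f i" "y \<in> g i" for x y
      using sub that by (auto simp: join_def insert_commute)
    have "edges G \<subseteq> edges (join G H)" "edges H \<subseteq> edges (join G H)"
      by (auto simp: join_def)
    then show ?thesis
      using sub e cross unfolding is_clique_def clique_def verts_join by blast
  qed
  moreover have "(\<Union>i<k. f i \<union> g i) = X \<union> Y" using f(2) g(2) by auto
  moreover have "X \<union> Y \<subseteq> verts (join G H)" using assms(4,5) by auto
  ultimately show ?thesis
    unfolding vcc_le_iff[OF fin(3) \<open>X \<union> Y \<subseteq> verts (join G H)\<close>]
    by (intro exI[of _ "\<lambda>i. f i \<union> g i"] conjI allI impI)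
qed

lemma vcc_join:
  assumes "simple_graph G" "simple_graph H" "verts G \<inter> verts H = {}"
  shows "vcc (join G H) (verts G \<union> verts H) = max (vcc G (verts G)) (vcc H (verts H))"
proof (rule antisym)
  have fin: "finite (verts (join G H))" using assms(1,2) by (simp add: simple_graph_iff)
  show "vcc (join G H) (verts G \<union> verts H) \<le> max (vcc G (verts G)) (vcc H (verts H))"
    by (rule vcc_join_le[OF assms]) simp_all
  have "vcc G (verts G) = vcc (join G H) (verts G)"
    using vcc_induced[of "verts G" "verts G" "join G H"] induced_join[OF assms] by simp
  moreover have "vcc H (verts H) = vcc (join G H) (verts H)"
    using vcc_induced[of "verts H" "verts H" "join H G"] induced_join[OF assms(2,1)] assms(3)
    by (simp add: Int_commute join_commute[of G H])
  ultimately show "max (vcc G (verts G)) (vcc H (verts H)) \<le> vcc (join G H) (verts G \<union> verts H)"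
    using vcc_mono[OF fin, of _ "verts G \<union> verts H"] by simp
qed

section \<open>Tree-clique width of unions and joins\<close>

lemma tree_decompositionD:
  assumes "tree_decomposition G T X"
  shows "is_tree T" "finite (verts T)" "verts T \<noteq> {}"
    "t \<in> verts T \<Longrightarrow> X t \<subseteq> verts G"
    "v \<in> verts G \<Longrightarrow> \<exists>t\<in>verts T. v \<in> X t"
    "e \<in> edges G \<Longrightarrow> \<exists>t\<in>verts T. e \<subseteq> X t"
    "v \<in> verts G \<Longrightarrow> connected_graph (induced T {t. v \<in> X t})"
  using assms
  by (auto simp: tree_decomposition_def is_tree_def simple_graph_def connected_graph_def)

lemma tree_decomposition_single_bag:
  assumes "simple_graph G"
  shows "tree_decomposition G ({0}, {}) (\<lambda>_. verts G)"
  using simple_graph_edge_subset[OF assms]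
  by (auto simp: tree_decomposition_def is_tree_singleton connected_graph_def induced_def)

text \<open>Trades \<open>LEAST\<close> and \<open>Max\<close> for one bound on all bags, the form
  in which decompositions can be transformed and combined.\<close>

lemma tcl_le_iff:
  assumes "simple_graph G"
  shows "tcl G \<le> k \<longleftrightarrow>
    (\<exists>T X. tree_decomposition G T X \<and> (\<forall>t\<in>verts T. vcc G (X t) \<le> k))"
proof -
  let ?P = "\<lambda>k. \<exists>T X. tree_decomposition G T X \<and> Max ((\<lambda>t. vcc G (X t)) ` verts T) = k"
  have fin: "finite (verts G)" using assms by (simp add: simple_graph_iff)
  have tcl: "tcl G = (LEAST k. ?P k)" by (rule tcl_eq_min_max_vcc[OF fin])
  have bags: "Max ((\<lambda>t. vcc G (X t)) ` verts T) \<le> k \<longleftrightarrow> (\<forall>t\<in>verts T. vcc G (X t) \<le> k)"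
    if "tree_decomposition G T X" for T X k
    using tree_decompositionD(2,3)[OF that] by (subst Max_le_iff) auto
  show ?thesis
  proof
    assume le: "tcl G \<le> k"
    \<comment> \<open>The single-bag decomposition makes the set of attained values non-empty, so
      the \<open>LEAST\<close> is attained.\<close>
    have "\<exists>k. ?P k" using tree_decomposition_single_bag[OF assms] by blast
    then have "?P (tcl G)" unfolding tcl by (rule LeastI_ex)
    then obtain T X where TX: "tree_decomposition G T X"
      "Max ((\<lambda>t. vcc G (X t)) ` verts T) \<le> k" using le by auto
    then show "\<exists>T X. tree_decomposition G T X \<and> (\<forall>t\<in>verts T. vcc G (X t) \<le> k)"
      using bags[OF TX(1)] by blast
  next
    assume "\<exists>T X. tree_decomposition G T X \<and> (\<forall>t\<in>verts T. vcc G (X t) \<le> k)"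
    then obtain T X where TX: "tree_decomposition G T X" "\<forall>t\<in>verts T. vcc G (X t) \<le> k"
      by blast
    have "tcl G \<le> Max ((\<lambda>t. vcc G (X t)) ` verts T)"
      unfolding tcl by (rule Least_le) (use TX(1) in blast)
    also have "\<dots> \<le> k" using bags[OF TX(1)] TX(2) by blast
    finally show "tcl G \<le> k" .
  qed
qed

text \<open>Intersect every bag with \<open>S\<close>: a vertex of \<open>S\<close> keeps exactly
  the nodes it had, and covers do not grow. Both operands are induced subgraphs of their union and
  of their join, so this bounds either width from below.\<close>

lemma tcl_induced_le:
  assumes "simple_graph G"
  shows "tcl (induced G S) \<le> tcl G"
proof -
  have fin: "finite (verts G)" using assms by (simp add: simple_graph_iff)
  obtain T X where TX: "tree_decomposition G T X" "\<forall>t\<in>verts T. vcc G (X t) \<le> tcl G"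
    using tcl_le_iff[OF assms, of "tcl G"] by auto
  note T = tree_decompositionD[OF TX(1)]
  have "tree_decomposition (induced G S) T (\<lambda>t. X t \<inter> S)"
    unfolding tree_decomposition_def
  proof (intro conjI ballI)
    fix v assume "v \<in> verts (induced G S)"
    then have v: "v \<in> verts G" "v \<in> S" by (auto simp: induced_def)
    then have "{t. v \<in> X t \<inter> S} = {t. v \<in> X t}" by blast
    then show "connected_graph (induced T {t. v \<in> X t \<inter> S})" using T(7)[OF v(1)] by simp
    show "\<exists>t\<in>verts T. v \<in> X t \<inter> S" using T(5)[OF v(1)] v(2) by blast
  next
    fix e assume "e \<in> edges (induced G S)"
    then have e: "e \<in> edges G" "e \<subseteq> S" by (auto simp: induced_def)
    then show "\<exists>t\<in>verts T. e \<subseteq> X t \<inter> S" using T(6)[OF e(1)] by blast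
  qed (use T(1,4) in \<open>auto simp: induced_def\<close>)
  moreover have "vcc (induced G S) (X t \<inter> S) \<le> tcl G" if "t \<in> verts T" for t
  proof -
    have "vcc (induced G S) (X t \<inter> S) = vcc G (X t \<inter> S)" by (rule vcc_induced) simp
    also have "\<dots> \<le> vcc G (X t)" using vcc_mono[OF fin _ T(4)[OF that]] by simp
    finally show ?thesis using TX(2) that by fastforce
  qed
  ultimately show ?thesis
    using tcl_le_iff[OF simple_graph_induced[OF assms]] by blast
qed

section \<open>Combining decompositions for disjoint unions\<close>

lemma adj_map_graph: "(x, y) \<in> adj G \<Longrightarrow> (f x, f y) \<in> adj (map_graph f G)"
  unfolding adj_def map_graph_def by (auto intro!: image_eqI[of _ _ "{x, y}"])

lemma connected_graph_map_graph:
  assumes "connected_graph G"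
  shows "connected_graph (map_graph f G)"
proof -
  have "(f x, f y) \<in> (adj (map_graph f G))\<^sup>*" if "(x, y) \<in> (adj G)\<^sup>*" for x y
    using that by induction (auto intro: rtrancl_into_rtrancl adj_map_graph)
  then show ?thesis using assms by (auto simp: connected_graph_adj map_graph_def)
qed

lemma induced_map_graph:
  "induced (map_graph f T) S = map_graph f (induced T (f -` S))"
  by (auto simp: induced_def map_graph_def)

text \<open>Decomposition nodes are natural numbers, so two trees must be renamed apart before they
  are glued. The left inverse \<open>g\<close> recovers the old name of a node and with it its
  bag.\<close>

lemma tree_decomposition_map_graph:
  assumes "tree_decomposition G T X" and gf: "\<And>x. g (f x) = x"
  shows "tree_decomposition G (map_graph f T) (\<lambda>t. X (g t))"
  unfolding tree_decomposition_def
proof (intro conjI ballI)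
  note T = tree_decompositionD[OF assms(1)]
  have "inj f" using gf by (metis injI)
  then show "is_tree (map_graph f T)" using T(1) by (intro is_tree_map_graph)
  show "X (g t) \<subseteq> verts G" if "t \<in> verts (map_graph f T)" for t
  proof -
    obtain u where "u \<in> verts T" "t = f u" using \<open>t \<in> verts (map_graph f T)\<close> by (auto simp: map_graph_def)
    then show ?thesis using T(4)[of u] gf by simp
  qed
  show "\<exists>t\<in>verts (map_graph f T). v \<in> X (g t)" if "v \<in> verts G" for v
    using T(5)[OF that] gf by (auto simp: map_graph_def)
  show "\<exists>t\<in>verts (map_graph f T). e \<subseteq> X (g t)" if "e \<in> edges G" for e
    using T(6)[OF that] gf by (auto simp: map_graph_def)
  show "connected_graph (induced (map_graph f T) {t. v \<in> X (g t)})" if "v \<in> verts G" for v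
    using connected_graph_map_graph[OF T(7)[OF that], of f] gf
    by (simp add: induced_map_graph vimage_def)
qed

text \<open>If \<open>S\<close> misses \<open>T2\<close>, neither the edges of \<open>T2\<close> nor
  the connecting edge survive in the induced graph. \<open>S\<close> and \<open>S'\<close> need to
  agree on \<open>T1\<close> only, because the common bag function of the glued tree differs from
  the original one elsewhere.\<close>

lemma induced_glue:
  assumes "simple_graph T1" "simple_graph T2" "a \<in> verts T1" "b \<in> verts T2"
    and S: "verts T2 \<inter> S = {}" "verts T1 \<inter> S = verts T1 \<inter> S'"
  shows "induced (verts T1 \<union> verts T2, insert {a, b} (edges T1 \<union> edges T2)) S = induced T1 S'"
proof -
  have "\<not> e \<subseteq> S" if e: "e \<in> edges T2" for e
  proof -
    obtain u where "u \<in> verts T2" "u \<in> e" using assms(2) e unfolding simple_graph_iff by blast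
    then show ?thesis using S(1) by blast
  qed
  moreover have "e \<subseteq> S \<longleftrightarrow> e \<subseteq> S'" if "e \<in> edges T1" for e
    using simple_graph_edge_subset[OF assms(1) that] S(2) by blast
  moreover have "\<not> {a, b} \<subseteq> S" using assms(4) S(1) by blast
  ultimately have "{e \<in> insert {a, b} (edges T1 \<union> edges T2). e \<subseteq> S} = {e \<in> edges T1. e \<subseteq> S'}"
    by blast
  then show ?thesis using S by (simp add: induced_def Int_Un_distrib2)
qed

lemma tcl_disjoint_union_le:
  assumes "simple_graph G" "simple_graph H" "verts G \<inter> verts H = {}"
    and "tcl G \<le> k" "tcl H \<le> k"
  shows "tcl (disjoint_union G H) \<le> k"
proof -
  obtain T0 X0 where 0: "tree_decomposition G T0 X0" "\<forall>t\<in>verts T0. vcc G (X0 t) \<le> k"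
    using assms(4) tcl_le_iff[OF assms(1)] by blast
  obtain T1 X1 where 1: "tree_decomposition H T1 X1" "\<forall>t\<in>verts T1. vcc H (X1 t) \<le> k"
    using assms(5) tcl_le_iff[OF assms(2)] by blast
  \<comment> \<open>The nodes of one tree become even and those of the other odd;
    \<open>t div 2\<close> is a left inverse of both renamings.\<close>
  define S0 S1 where "S0 = map_graph (\<lambda>n. 2 * n) T0" and "S1 = map_graph (\<lambda>n. 2 * n + 1) T1"
  define X where "X t = (if even t then X0 (t div 2) else X1 (t div 2))" for t :: nat
  have S0: "tree_decomposition G S0 (\<lambda>t. X0 (t div 2))"
    unfolding S0_def by (rule tree_decomposition_map_graph[OF 0(1)]) simp
  have S1: "tree_decomposition H S1 (\<lambda>t. X1 (t div 2))"
    unfolding S1_def by (rule tree_decomposition_map_graph[OF 1(1)]) simp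
  have ev: "even t" "vcc G (X t) \<le> k" if "t \<in> verts S0" for t
    using that 0(2) by (auto simp: S0_def map_graph_def X_def)
  have od: "odd t" "vcc H (X t) \<le> k" if "t \<in> verts S1" for t
    using that 1(2) by (auto simp: S1_def map_graph_def X_def)
  have disj: "verts S0 \<inter> verts S1 = {}" using ev(1) od(1) by blast
  note T0 = tree_decompositionD[OF S0] and T1 = tree_decompositionD[OF S1]
  have simple: "simple_graph S0" "simple_graph S1" using T0(1) T1(1) by (auto simp: is_tree_def)
  have X0: "X t = X0 (t div 2)" "X t \<subseteq> verts G" if "t \<in> verts S0" for t
    using ev(1)[OF that] T0(4)[OF that] by (simp_all add: X_def)
  have X1: "X t = X1 (t div 2)" "X t \<subseteq> verts H" if "t \<in> verts S1" for t
    using od(1)[OF that] T1(4)[OF that] by (simp_all add: X_def)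
  obtain a b where ab: "a \<in> verts S0" "b \<in> verts S1"
    "is_tree (verts S0 \<union> verts S1, insert {a, b} (edges S0 \<union> edges S1))"
    using is_tree_glue[OF T1(1) T0(1) disj] by blast
  define T where "T = (verts S0 \<union> verts S1, insert {a, b} (edges S0 \<union> edges S1))"
  have indG: "induced T {t. v \<in> X t} = induced S0 {t. v \<in> X0 (t div 2)}" if "v \<in> verts G" for v
    unfolding T_def
  proof (rule induced_glue[OF simple ab(1,2)])
    show "verts S1 \<inter> {t. v \<in> X t} = {}" using X1(2) that assms(3) by blast
    show "verts S0 \<inter> {t. v \<in> X t} = verts S0 \<inter> {t. v \<in> X0 (t div 2)}" using X0(1) by auto
  qed
  have T': "T = (verts S1 \<union> verts S0, insert {b, a} (edges S1 \<union> edges S0))"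
    by (simp add: T_def Un_commute insert_commute)
  have indH: "induced T {t. v \<in> X t} = induced S1 {t. v \<in> X1 (t div 2)}" if "v \<in> verts H" for v
    unfolding T'
  proof (rule induced_glue[OF simple(2,1) ab(2,1)])
    show "verts S0 \<inter> {t. v \<in> X t} = {}" using X0(2) that assms(3) by blast
    show "verts S1 \<inter> {t. v \<in> X t} = verts S1 \<inter> {t. v \<in> X1 (t div 2)}" using X1(1) by auto
  qed
  have "tree_decomposition (disjoint_union G H) T X"
    unfolding tree_decomposition_def
  proof (intro conjI ballI)
    show "is_tree T" using ab(3) by (simp add: T_def)
    show "X t \<subseteq> verts (disjoint_union G H)" if "t \<in> verts T" for t
      using that X0(2)[of t] X1(2)[of t] by (auto simp: T_def)
    fix v assume "v \<in> verts (disjoint_union G H)"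
    then consider "v \<in> verts G" | "v \<in> verts H" by auto
    then show "\<exists>t\<in>verts T. v \<in> X t"
    proof cases
      case 1
      then obtain t where "t \<in> verts S0" "v \<in> X0 (t div 2)" using T0(5) by blast
      then show ?thesis using X0(1) by (auto simp: T_def)
    next
      case 2
      then obtain t where "t \<in> verts S1" "v \<in> X1 (t div 2)" using T1(5) by blast
      then show ?thesis using X1(1) by (auto simp: T_def)
    qed
  next
    fix e assume "e \<in> edges (disjoint_union G H)"
    then consider "e \<in> edges G" | "e \<in> edges H" by (auto simp: disjoint_union_def)
    then show "\<exists>t\<in>verts T. e \<subseteq> X t"
    proof cases
      case 1
      then obtain t where "t \<in> verts S0" "e \<subseteq> X0 (t div 2)" using T0(6) by blast
      then show ?thesis using X0(1)[of t] by (intro bexI[of _ t]) (simp_all add: T_def)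
    next
      case 2
      then obtain t where "t \<in> verts S1" "e \<subseteq> X1 (t div 2)" using T1(6) by blast
      then show ?thesis using X1(1)[of t] by (intro bexI[of _ t]) (simp_all add: T_def)
    qed
  next
    show "connected_graph (induced T {t. v \<in> X t})" if "v \<in> verts (disjoint_union G H)" for v
      using that T0(7) T1(7) indG indH by auto
  qed
  moreover have "vcc (disjoint_union G H) (X t) \<le> k" if "t \<in> verts T" for t
  proof -
    consider "t \<in> verts S0" | "t \<in> verts S1" using \<open>t \<in> verts T\<close> by (auto simp: T_def)
    then show ?thesis
    proof cases
      case 1
      then show ?thesis
        using vcc_induced[OF X0(2)[OF 1], of "disjoint_union G H"] ev(2)[OF 1]
          induced_disjoint_union[OF assms(1-3)] by simp
    next
      case 2
      then show ?thesis
        using vcc_induced[OF X1(2)[OF 2], of "disjoint_union H G"] od(2)[OF 2] assms(3)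
          induced_disjoint_union[OF assms(2,1)] by (simp add: Int_commute disjoint_union_commute)
    qed
  qed
  ultimately show ?thesis
    using tcl_le_iff[OF simple_graph_disjoint_union[OF assms(1,2)]] by blast
qed

lemma tcl_le_disjoint_union:
  assumes "simple_graph G" "simple_graph H" "verts G \<inter> verts H = {}"
  shows "tcl G \<le> tcl (disjoint_union G H)"
  using tcl_induced_le[OF simple_graph_disjoint_union[OF assms(1,2)], of "verts G"]
    induced_disjoint_union[OF assms] by simp

lemma tcl_disjoint_union:
  assumes "simple_graph G" "simple_graph H" "verts G \<inter> verts H = {}"
  shows "tcl (disjoint_union G H) = max (tcl G) (tcl H)"
  using tcl_disjoint_union_le[OF assms, of "max (tcl G) (tcl H)"] tcl_le_disjoint_union[OF assms]
    tcl_le_disjoint_union[OF assms(2,1)] assms(3)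
  by (intro antisym) (simp_all add: Int_commute disjoint_union_commute[of H G])

section \<open>The width of joins\<close>

lemma tcl_join_le:
  assumes "simple_graph G" "simple_graph H" "verts G \<inter> verts H = {}"
    and "tcl G \<le> k" "vcc H (verts H) \<le> k"
  shows "tcl (join G H) \<le> k"
proof -
  obtain T X where TX: "tree_decomposition G T X" "\<forall>t\<in>verts T. vcc G (X t) \<le> k"
    using assms(4) tcl_le_iff[OF assms(1)] by blast
  note T = tree_decompositionD[OF TX(1)]
  have "tree_decomposition (join G H) T (\<lambda>t. X t \<union> verts H)"
    unfolding tree_decomposition_def
  proof (intro conjI ballI)
    show "is_tree T" by (rule T(1))
    show "X t \<union> verts H \<subseteq> verts (join G H)" if "t \<in> verts T" for t
      using T(4)[OF that] by auto
    show "\<exists>t\<in>verts T. v \<in> X t \<union> verts H" if "v \<in> verts (join G H)" for v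
      using that T(5)[of v] T(3) by auto
    show "\<exists>t\<in>verts T. e \<subseteq> X t \<union> verts H" if "e \<in> edges (join G H)" for e
    proof -
      consider "e \<in> edges G" | "e \<in> edges H"
        | v w where "v \<in> verts G" "w \<in> verts H" "e = {v, w}"
        using \<open>e \<in> edges (join G H)\<close> by (auto simp: join_def)
      then show ?thesis
      proof cases
        case 1
        then show ?thesis using T(6)[OF 1] by blast
      next
        case 2
        then show ?thesis using T(3) simple_graph_edge_subset[OF assms(2) 2] by blast
      next
        case 3
        then show ?thesis using T(5)[of v] by auto
      qed
    qed
    show "connected_graph (induced T {t. v \<in> X t \<union> verts H})" if "v \<in> verts (join G H)" for v
    proof (cases "v \<in> verts H")
      case True
      \<comment> \<open>A vertex of \<open>H\<close> now lies in every bag, so its nodes form the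
        whole tree.\<close>
      then have "induced T {t. v \<in> X t \<union> verts H} = T" by (simp add: induced_def)
      then show ?thesis using T(1) by (simp add: is_tree_def)
    next
      case False
      then show ?thesis using T(7)[of v] that by simp
    qed
  qed
  moreover have "vcc (join G H) (X t \<union> verts H) \<le> k" if "t \<in> verts T" for t
    using vcc_join_le[OF assms(1-3) T(4)[OF that] order_refl] TX(2) that assms(5) by blast
  ultimately show ?thesis using tcl_le_iff[OF simple_graph_join[OF assms(1-3)]] by blast
qed

lemma le_tcl_join:
  assumes "simple_graph G" "simple_graph H" "verts G \<inter> verts H = {}"
  shows "min (vcc G (verts G)) (vcc H (verts H)) \<le> tcl (join G H)"
proof -
  have simple: "simple_graph (join G H)" using assms by (rule simple_graph_join)
  have fin: "finite (verts (join G H))" using simple by (simp add: simple_graph_iff)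
  obtain T X where TX: "tree_decomposition (join G H) T X"
    "\<forall>t\<in>verts T. vcc (join G H) (X t) \<le> tcl (join G H)"
    using tcl_le_iff[OF simple, of "tcl (join G H)"] by auto
  note T = tree_decompositionD[OF TX(1)]
  have "\<exists>t\<in>verts T. verts G \<subseteq> X t \<or> verts H \<subseteq> X t"
  proof (rule biclique_side_in_bag[OF T(1)])
    show "\<forall>v\<in>verts G \<union> verts H. connected_graph (induced T {t. v \<in> X t})" using T(7) by simp
    \<comment> \<open>Every cross pair is an edge and so shares a bag, which is the hypothesis on
      pairs in the bag lemma.\<close>
    have "{a, b} \<in> edges (join G H)" if "a \<in> verts G" "b \<in> verts H" for a b
      using that by (auto simp: join_def)
    then show "\<forall>a\<in>verts G. \<forall>b\<in>verts H. \<exists>t\<in>verts T. a \<in> X t \<and> b \<in> X t"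
      using T(6) by fastforce
  qed
  then obtain t where t: "t \<in> verts T" "verts G \<subseteq> X t \<or> verts H \<subseteq> X t" by blast
  have "vcc G (verts G) = vcc (join G H) (verts G)"
    using vcc_induced[of "verts G" "verts G" "join G H"] induced_join[OF assms] by simp
  moreover have "vcc H (verts H) = vcc (join G H) (verts H)"
    using vcc_induced[of "verts H" "verts H" "join H G"] induced_join[OF assms(2,1)] assms(3)
    by (simp add: Int_commute join_commute[of G H])
  ultimately have "vcc G (verts G) \<le> vcc (join G H) (X t) \<or>
      vcc H (verts H) \<le> vcc (join G H) (X t)"
    using t(2) vcc_mono[OF fin _ T(4)[OF t(1)]] by auto
  then show ?thesis using TX(2) t(1) by fastforce
qed

lemma tcl_le_join:
  assumes "simple_graph G" "simple_graph H" "verts G \<inter> verts H = {}"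
  shows "tcl G \<le> tcl (join G H)"
  using tcl_induced_le[OF simple_graph_join[OF assms], of "verts G"] induced_join[OF assms] by simp

lemma tcl_join:
  assumes "simple_graph G" "simple_graph H" "verts G \<inter> verts H = {}"
  shows "tcl (join G H) =
    max (max (tcl G) (tcl H)) (min (vcc G (verts G)) (vcc H (verts H)))"
    (is "_ = ?m")
proof (rule antisym)
  have assms': "simple_graph H" "simple_graph G" "verts H \<inter> verts G = {}" using assms by auto
  show "tcl (join G H) \<le> ?m"
    \<comment> \<open>The operand with the smaller vcc is the one added to all bags of the other;
      its vcc is then the minimum occurring in \<open>?m\<close>.\<close>
    using tcl_join_le[OF assms, of ?m] tcl_join_le[OF assms', of ?m]
    unfolding join_commute[of H G] by (cases "vcc G (verts G) \<le> vcc H (verts H)") auto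
  show "?m \<le> tcl (join G H)"
    using tcl_le_join[OF assms] tcl_le_join[OF assms'] le_tcl_join[OF assms]
    unfolding join_commute[of H G] by simp
qed

lemma vcc_singleton: "vcc ({v}, {}) {v} = 1"
proof -
  have "vcc ({v}, {}) {v} \<le> 1"
    by (subst vcc_le_iff) (auto simp: is_clique_def clique_def)
  moreover have "\<not> vcc ({v}, {}) {v} \<le> 0"
    by (subst vcc_le_iff) auto
  ultimately show ?thesis by linarith
qed

lemma tcl_singleton: "tcl ({v}, {}) = 1"
proof -
  have simple: "simple_graph ({v}, {})" by (simp add: simple_graph_iff)
  have "tcl ({v}, {}) \<le> 1"
    unfolding tcl_le_iff[OF simple]
    using tree_decomposition_single_bag[OF simple] vcc_singleton[of v] by fastforce
  moreover have "\<not> tcl ({v}, {}) \<le> 0"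
  proof
    assume "tcl ({v}, {}) \<le> 0"
    then obtain T X where TX: "tree_decomposition ({v}, {}) T X"
      "\<forall>t\<in>verts T. vcc ({v}, {}) (X t) \<le> 0"
      unfolding tcl_le_iff[OF simple] by blast
    \<comment> \<open>Some bag contains \<open>v\<close>, hence equals \<open>{v}\<close>, and one
      clique is needed for it.\<close>
    obtain t where t: "t \<in> verts T" "v \<in> X t" using tree_decompositionD(5)[OF TX(1), of v] by auto
    then have "X t = {v}" using tree_decompositionD(4)[OF TX(1) t(1)] by auto
    then show False using TX(2) t(1) vcc_singleton[of v] by fastforce
  qed
  ultimately show ?thesis by linarith
qed

section \<open>Evaluation along a cotree\<close>

fun cotree_vcc :: "'v cotree \<Rightarrow> nat" where
  "cotree_vcc (Leaf v) = 1"
| "cotree_vcc (Node0 l r) = cotree_vcc l + cotree_vcc r"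
| "cotree_vcc (Node1 l r) = max (cotree_vcc l) (cotree_vcc r)"

fun cotree_tcl :: "'v cotree \<Rightarrow> nat" where
  "cotree_tcl (Leaf v) = 1"
| "cotree_tcl (Node0 l r) = max (cotree_tcl l) (cotree_tcl r)"
| "cotree_tcl (Node1 l r) =
     max (max (cotree_tcl l) (cotree_tcl r)) (min (cotree_vcc l) (cotree_vcc r))"

lemma cotree_vcc_pos: "0 < cotree_vcc t"
  by (induction t) auto

lemma cotree_vcc_le_num_nodes: "cotree_vcc t \<le> num_nodes t"
  by (induction t) auto

lemma binary_cotree_tcl:
  assumes "binary_cotree t G"
  shows "simple_graph G \<and> vcc G (verts G) = cotree_vcc t \<and> tcl G = cotree_tcl t"
  using assms
proof induction
  case (Leaf v)
  then show ?case by (simp add: simple_graph_iff vcc_singleton tcl_singleton)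
next
  case (Node0 l G r H)
  then show ?case
    by (simp add: simple_graph_disjoint_union vcc_disjoint_union tcl_disjoint_union)
next
  case (Node1 l G r H)
  then show ?case by (simp add: simple_graph_join vcc_join tcl_join)
qed

section \<open>The word RAM program\<close>

text \<open>
  Registers: 0 the input length, 1 the stack pointer, 2 the current node, 3, 10 and 11 the constants
  1, 0 and 3, 4 and 5 the returned values of \<open>vcc\<close> and \<open>tcl\<close>, 6 to 9 scratch. A stack frame
  has three words: the address of the node's label, then \<open>vcc\<close> and \<open>tcl\<close> of its left child.
  Since \<open>vcc\<close> is positive, a 0 in the second word means that the left child is still being
  evaluated.
\<close>

definition tcl_program :: "instr list" where
  "tcl_program =
    [Const 3 1, Const 11 3, Add 1 0 10, Load 2 10,
     \<comment> \<open>4: evaluate the node whose number is in register 2\<close>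
     Add 6 2 2, Add 6 6 2, Add 2 6 3, Load 7 2, Jless 3 7 16,
     Store 1 2, Add 6 1 3, Store 6 10, Add 1 1 11, Add 6 2 3, Load 2 6, Jump 4,
     Const 4 1, Const 5 1,
     \<comment> \<open>18: return the values in registers 4 and 5 to the top frame; halt if there is none\<close>
     Jless 0 1 21, Add 0 5 10, Jump 52,
     Sub 6 1 11, Add 7 6 3, Load 8 7, Jless 10 8 33,
     Store 7 4, Add 7 7 3, Store 7 5, Load 2 6, Add 2 2 3, Add 2 2 3, Load 2 2, Jump 4,
     \<comment> \<open>33: both children are done, pop the frame and combine\<close>
     Add 1 6 10, Add 7 7 3, Load 9 7, Load 7 6, Load 7 7,
     Jless 9 5 40, Add 5 9 10, Jless 10 7 43, Add 4 4 8, Jump 18,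
     Jless 4 8 46, Add 9 8 10, Jump 48, Add 9 4 10, Add 4 8 10,
     Jless 5 9 50, Jump 18, Add 5 9 10, Jump 18]"

text \<open>An upper bound on the steps rather than their exact number, so that branches of
  different length share a bound. The slack is harmless in the end because a halted machine stays in
  its state.\<close>

definition reaches :: "nat \<Rightarrow> instr list \<Rightarrow> nat \<Rightarrow> state \<Rightarrow> state \<Rightarrow> bool" where
  "reaches w P k s s' \<longleftrightarrow> (\<exists>j\<le>k. (step w P ^^ j) s = s')"

lemma reaches_trans:
  assumes "reaches w P k s s'" "reaches w P l s' s''"
  shows "reaches w P (k + l) s s''"
proof -
  obtain i j where "i \<le> k" "(step w P ^^ i) s = s'" "j \<le> l" "(step w P ^^ j) s' = s''"
    using assms unfolding reaches_def by blast
  then show ?thesis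
    unfolding reaches_def by (intro exI[of _ "j + i"]) (simp add: funpow_add)
qed

text \<open>Shapes a run for symbolic execution: the simplifier computes the final registers, which
  instantiate \<open>f'\<close>, and afterwards only the facts in \<open>Q\<close> are kept.\<close>

lemma reachesI:
  assumes "\<exists>f'. (step w P ^^ k) s = \<lparr>pc = p, regs = f', mem = m\<rparr> \<and> Q f'" "k \<le> l"
  shows "\<exists>f'. reaches w P l s \<lparr>pc = p, regs = f', mem = m\<rparr> \<and> Q f'"
  using assms unfolding reaches_def by blast

lemma reaches_mono: "reaches w P k s s' \<Longrightarrow> k \<le> l \<Longrightarrow> reaches w P l s s'"
  unfolding reaches_def using le_trans by blast

lemma halted_funpow: "halted P s \<Longrightarrow> (step w P ^^ k) s = s"
  by (induction k) (simp_all add: step_def)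

lemma computes_withinI:
  assumes "reaches w P k (init_state xs) s" "halted P s" "regs s 0 = y"
  shows "computes_within w P xs y k"
proof -
  obtain j where j: "j \<le> k" "(step w P ^^ j) (init_state xs) = s"
    using assms(1) unfolding reaches_def by blast
  have "(step w P ^^ (k - j + j)) (init_state xs) = s"
    unfolding funpow_add comp_apply j(2) using assms(2) by (rule halted_funpow)
  then show ?thesis
    using j(1) assms(2,3) by (simp add: computes_within_def)
qed

section \<open>Symbolic execution of the pieces of the program\<close>

lemma nth_tcl_program:
  "tcl_program ! 0 = Const 3 1" "tcl_program ! Suc 0 = Const 11 3"
  "tcl_program ! 2 = Add 1 0 10" "tcl_program ! 3 = Load 2 10"
  "tcl_program ! 4 = Add 6 2 2" "tcl_program ! 5 = Add 6 6 2" "tcl_program ! 6 = Add 2 6 3"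
  "tcl_program ! 7 = Load 7 2" "tcl_program ! 8 = Jless 3 7 16" "tcl_program ! 9 = Store 1 2"
  "tcl_program ! 10 = Add 6 1 3" "tcl_program ! 11 = Store 6 10" "tcl_program ! 12 = Add 1 1 11"
  "tcl_program ! 13 = Add 6 2 3" "tcl_program ! 14 = Load 2 6" "tcl_program ! 15 = Jump 4"
  "tcl_program ! 16 = Const 4 1" "tcl_program ! 17 = Const 5 1" "tcl_program ! 18 = Jless 0 1 21"
  "tcl_program ! 19 = Add 0 5 10" "tcl_program ! 20 = Jump 52" "tcl_program ! 21 = Sub 6 1 11"
  "tcl_program ! 22 = Add 7 6 3" "tcl_program ! 23 = Load 8 7" "tcl_program ! 24 = Jless 10 8 33"
  "tcl_program ! 25 = Store 7 4" "tcl_program ! 26 = Add 7 7 3" "tcl_program ! 27 = Store 7 5"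
  "tcl_program ! 28 = Load 2 6" "tcl_program ! 29 = Add 2 2 3" "tcl_program ! 30 = Add 2 2 3"
  "tcl_program ! 31 = Load 2 2" "tcl_program ! 32 = Jump 4" "tcl_program ! 33 = Add 1 6 10"
  "tcl_program ! 34 = Add 7 7 3" "tcl_program ! 35 = Load 9 7" "tcl_program ! 36 = Load 7 6"
  "tcl_program ! 37 = Load 7 7" "tcl_program ! 38 = Jless 9 5 40" "tcl_program ! 39 = Add 5 9 10"
  "tcl_program ! 40 = Jless 10 7 43" "tcl_program ! 41 = Add 4 4 8" "tcl_program ! 42 = Jump 18"
  "tcl_program ! 43 = Jless 4 8 46" "tcl_program ! 44 = Add 9 8 10" "tcl_program ! 45 = Jump 48"
  "tcl_program ! 46 = Add 9 4 10" "tcl_program ! 47 = Add 4 8 10" "tcl_program ! 48 = Jless 5 9 50"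
  "tcl_program ! 49 = Jump 18" "tcl_program ! 50 = Add 5 9 10" "tcl_program ! 51 = Jump 18"
  by (simp_all add: tcl_program_def)

lemma length_tcl_program: "length tcl_program = 52"
  by (simp add: tcl_program_def)

lemma step_tcl_program:
  "p < 52 \<Longrightarrow> step w tcl_program \<lparr>pc = p, regs = f, mem = m\<rparr> =
     exec_instr w (tcl_program ! p) \<lparr>pc = p, regs = f, mem = m\<rparr>"
  by (simp add: step_def halted_def length_tcl_program)

lemma funpow_numeral_unroll: "(f ^^ numeral k) x = (f ^^ pred_numeral k) (f x)"
  by (simp add: numeral_eq_Suc funpow_swap1)

lemmas run_simps = funpow_numeral_unroll step_tcl_program nth_tcl_program

text \<open>Needed for the one subtraction of the program, which moves from the stack pointer back
  to the top frame and never goes below zero.\<close>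

lemma sub_mod_word:
  fixes a b N :: nat
  assumes "b \<le> a" "a < N"
  shows "(a + N - b) mod N = a - b"
proof -
  have "a + N - b = (a - b) + N" using assms by simp
  then show ?thesis using assms by (simp only: mod_add_self2) simp
qed

text \<open>The bound on \<open>2 ^ w\<close> lets the constants 1 and 3 survive reduction. The
  stack starts right behind the input, at the address given by its length, and register 10 can serve
  as the constant 0 because it is 0 initially.\<close>

lemma run_start:
  assumes "3 < (2::nat) ^ w" "f 0 < 2 ^ w" "f 10 = 0"
  shows "\<exists>f'. reaches w tcl_program 4 \<lparr>pc = 0, regs = f, mem = m\<rparr>
           \<lparr>pc = 4, regs = f', mem = m\<rparr> \<and>
         f' 0 = f 0 \<and> f' 1 = f 0 \<and> f' 2 = m 0 \<and> f' 3 = 1 \<and> f' 10 = 0 \<and> f' 11 = 3"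
proof -
  have "0 < w" using assms(1) by (cases w) auto
  then show ?thesis
    using assms by (intro reachesI[OF _ order_refl]) (simp add: run_simps numeral_2_eq_2[symmetric])
qed

lemma run_halt:
  assumes "f 1 \<le> f 0" "f 5 < 2 ^ w" "f 10 = 0"
  shows "\<exists>f'. reaches w tcl_program 3 \<lparr>pc = 18, regs = f, mem = m\<rparr>
           \<lparr>pc = 52, regs = f', mem = m\<rparr> \<and> f' 0 = f 5"
  using assms by (intro reachesI[OF _ order_refl]) (simp add: run_simps)

lemma run_leaf:
  assumes "1 < (2::nat) ^ w" "3 * f 2 + 1 < 2 ^ w" "f 3 = 1" "m (3 * f 2 + 1) = 2"
  shows "\<exists>f'. reaches w tcl_program 7 \<lparr>pc = 4, regs = f, mem = m\<rparr>
           \<lparr>pc = 18, regs = f', mem = m\<rparr> \<and>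
         (\<forall>r\<in>{0, 1, 3, 10, 11}. f' r = f r) \<and> f' 4 = 1 \<and> f' 5 = 1"
proof -
  have "0 < w" using assms(1) by (cases w) auto
  moreover have triple: "f 2 + f 2 + f 2 = 3 * f 2" by simp
  ultimately show ?thesis
    using assms by (intro reachesI[OF _ order_refl]) (simp add: run_simps triple)
qed

text \<open>By \<open>3 * f 2 + 2 < f 1\<close> the word naming the left child lies below the new
  frame, so it is still intact when it is loaded after the two stores. The third word of the frame
  is filled only when the left child returns.\<close>

lemma run_push:
  assumes "f 1 + 3 < 2 ^ w" "f 3 = 1" "f 10 = 0" "f 11 = 3"
    "m (3 * f 2 + 1) \<le> 1" "3 * f 2 + 2 < f 1"
  shows "\<exists>f'. reaches w tcl_program 12 \<lparr>pc = 4, regs = f, mem = m\<rparr>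
           \<lparr>pc = 4, regs = f', mem = m(f 1 := 3 * f 2 + 1, f 1 + 1 := 0)\<rparr> \<and>
         (\<forall>r\<in>{0, 3, 10, 11}. f' r = f r) \<and> f' 1 = f 1 + 3 \<and> f' 2 = m (3 * f 2 + 2)"
proof -
  have triple: "f 2 + f 2 + f 2 = 3 * f 2" by simp
  show ?thesis
    using assms by (intro reachesI[OF _ order_refl]) (simp add: run_simps triple)
qed

text \<open>The frame holds the label address \<open>a\<close>, so the number of the right child is
  found at \<open>a + 2\<close>, inside the input and out of reach of the stores into the
  frame.\<close>

lemma run_right:
  assumes "f 0 \<le> sp" "f 1 = sp + 3" "sp + 3 < 2 ^ w" "f 3 = 1" "f 10 = 0" "f 11 = 3"
    "m sp = a" "m (sp + 1) = 0" "a + 2 < f 0"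
  shows "\<exists>f'. reaches w tcl_program 13 \<lparr>pc = 18, regs = f, mem = m\<rparr>
           \<lparr>pc = 4, regs = f', mem = m(sp + 1 := f 4, sp + 2 := f 5)\<rparr> \<and>
         (\<forall>r\<in>{0, 1, 3, 10, 11}. f' r = f r) \<and> f' 2 = m (a + 2)"
  using assms by (intro reachesI[OF _ order_refl]) (simp add: run_simps sub_mod_word)

text \<open>Both kinds of node take the maximum of the two tcl values, so this happens here, before
  the label is tested. The run ends exactly at that test.\<close>

lemma run_pop:
  assumes "f 0 \<le> sp" "f 1 = sp + 3" "sp + 3 < 2 ^ w" "f 3 = 1" "f 10 = 0" "f 11 = 3"
    "0 < m (sp + 1)" "m (sp + 2) < 2 ^ w"
  shows "\<exists>f'. reaches w tcl_program 12 \<lparr>pc = 18, regs = f, mem = m\<rparr>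
           \<lparr>pc = 40, regs = f', mem = m\<rparr> \<and>
         (\<forall>r\<in>{0, 3, 4, 10, 11}. f' r = f r) \<and> f' 1 = sp \<and>
         f' 5 = max (m (sp + 2)) (f 5) \<and> f' 7 = m (m sp) \<and> f' 8 = m (sp + 1)"
proof (cases "m (sp + 2) < f 5")
  case True
  then show ?thesis
    using assms by (intro reachesI[where k = 11]) (simp_all add: run_simps sub_mod_word)
next
  case False
  then show ?thesis
    using assms by (intro reachesI[OF _ order_refl]) (simp add: run_simps sub_mod_word)
qed

lemma run_union:
  assumes "f 10 = 0" "f 7 = 0" "f 4 + f 8 < 2 ^ w"
  shows "\<exists>f'. reaches w tcl_program 3 \<lparr>pc = 40, regs = f, mem = m\<rparr>
           \<lparr>pc = 18, regs = f', mem = m\<rparr> \<and>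
         (\<forall>r\<in>{0, 1, 3, 5, 10, 11}. f' r = f r) \<and> f' 4 = f 8 + f 4"
  using assms by (intro reachesI[OF _ order_refl]) (simp add: run_simps)

lemma run_join:
  assumes "f 10 = 0" "0 < f 7" "f 4 < 2 ^ w" "f 8 < 2 ^ w"
  shows "\<exists>f'. reaches w tcl_program 7 \<lparr>pc = 40, regs = f, mem = m\<rparr>
           \<lparr>pc = 18, regs = f', mem = m\<rparr> \<and>
         (\<forall>r\<in>{0, 1, 3, 10, 11}. f' r = f r) \<and>
         f' 4 = max (f 8) (f 4) \<and> f' 5 = max (f 5) (min (f 8) (f 4))"
proof -
  \<comment> \<open>The first half sorts the two vcc values, with the larger going to register 4 and
    the smaller to register 9; the second half raises tcl to the smaller one if necessary.\<close>
  have "\<exists>f'. reaches w tcl_program 4 \<lparr>pc = 40, regs = f, mem = m\<rparr>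
           \<lparr>pc = 48, regs = f', mem = m\<rparr> \<and>
         (\<forall>r\<in>{0, 1, 3, 5, 10, 11}. f' r = f r) \<and>
         f' 4 = max (f 8) (f 4) \<and> f' 9 = min (f 8) (f 4)"
    using assms by (cases "f 4 < f 8"; intro reachesI[OF _ order_refl]) (simp_all add: run_simps)
  then obtain g where g: "reaches w tcl_program 4 \<lparr>pc = 40, regs = f, mem = m\<rparr>
      \<lparr>pc = 48, regs = g, mem = m\<rparr>"
    "\<forall>r\<in>{0, 1, 3, 5, 10, 11}. g r = f r" "g 4 = max (f 8) (f 4)" "g 9 = min (f 8) (f 4)"
    by blast
  have "\<exists>f'. reaches w tcl_program 3 \<lparr>pc = 48, regs = g, mem = m\<rparr>
           \<lparr>pc = 18, regs = f', mem = m\<rparr> \<and>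
         (\<forall>r\<in>{0, 1, 3, 4, 10, 11}. f' r = g r) \<and> f' 5 = max (g 5) (g 9)"
  proof (cases "g 5 < g 9")
    case True
    then show ?thesis
      using assms g(2-) by (intro reachesI[where k = 3]) (simp_all add: run_simps)
  next
    case False
    then show ?thesis
      by (intro reachesI[where k = 2]) (simp_all add: run_simps)
  qed
  then obtain h where h: "reaches w tcl_program 3 \<lparr>pc = 48, regs = g, mem = m\<rparr>
      \<lparr>pc = 18, regs = h, mem = m\<rparr>"
    "\<forall>r\<in>{0, 1, 3, 4, 10, 11}. h r = g r" "h 5 = max (g 5) (g 9)"
    by blast
  have "reaches w tcl_program 7 \<lparr>pc = 40, regs = f, mem = m\<rparr>
      \<lparr>pc = 18, regs = h, mem = m\<rparr>"
    using reaches_trans[OF g(1) h(1)] by simp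
  then show ?thesis using g(2-) h(2-) by (intro exI[of _ h]) simp
qed

text \<open>At a join the new term is a minimum of what vcc takes the maximum of. Together with
  \<open>cotree_vcc_le_num_nodes\<close> this keeps every computed value within a word.\<close>

lemma cotree_tcl_le_vcc: "cotree_tcl t \<le> cotree_vcc t"
  by (induction t) auto

text \<open>The contract of a recursive call. Memory below the stack pointer is preserved, which
  protects the input and all pending frames; each pending node occupies three words, whence the
  bound on \<open>2 ^ w\<close>. Quantifying over \<open>f\<close> and \<open>m\<close> lets the
  contract be used for both children, which start from different states. The 44 is the 37 of
  \<open>run_children\<close> plus the 7 of \<open>run_join\<close>.\<close>

definition evaluates :: "nat \<Rightarrow> nat list \<Rightarrow> nat cotree \<Rightarrow> bool" where
  "evaluates w xs t \<longleftrightarrow> (\<forall>f m.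
     node_at xs (f 2) t \<and> (\<forall>j<length xs. m j = xs ! j) \<and>
     f 0 = length xs \<and> length xs \<le> f 1 \<and> f 1 + 3 * num_nodes t < 2 ^ w \<and>
     f 3 = 1 \<and> f 10 = 0 \<and> f 11 = 3 \<longrightarrow>
     (\<exists>f' m'. reaches w tcl_program (44 * num_nodes t)
        \<lparr>pc = 4, regs = f, mem = m\<rparr> \<lparr>pc = 18, regs = f', mem = m'\<rparr> \<and>
      (\<forall>r\<in>{0, 1, 3, 10, 11}. f' r = f r) \<and> (\<forall>j<f 1. m' j = m j) \<and>
      f' 4 = cotree_vcc t \<and> f' 5 = cotree_tcl t))"

text \<open>Unions and joins run identically up to the label test, so their common part is treated
  once. The 37 is 12 for \<open>run_push\<close>, 13 for \<open>run_right\<close> and 12 for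
  \<open>run_pop\<close>.\<close>

lemma run_children:
  assumes "evaluates w xs l" "evaluates w xs r"
    and i: "3 * f 2 + 3 < length xs" "xs ! (3 * f 2 + 1) \<le> 1"
      "node_at xs (xs ! (3 * f 2 + 2)) l" "node_at xs (xs ! (3 * f 2 + 3)) r"
    and m: "\<forall>j<length xs. m j = xs ! j"
    and f: "f 0 = length xs" "length xs \<le> f 1"
      "f 1 + 3 * (1 + num_nodes l + num_nodes r) < 2 ^ w" "f 3 = 1" "f 10 = 0" "f 11 = 3"
  shows "\<exists>f' m'. reaches w tcl_program (37 + 44 * num_nodes l + 44 * num_nodes r)
      \<lparr>pc = 4, regs = f, mem = m\<rparr> \<lparr>pc = 40, regs = f', mem = m'\<rparr> \<and>
      (\<forall>r\<in>{0, 1, 3, 10, 11}. f' r = f r) \<and> (\<forall>j<f 1. m' j = m j) \<and>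
      f' 4 = cotree_vcc r \<and> f' 5 = max (cotree_tcl l) (cotree_tcl r) \<and>
      f' 7 = xs ! (3 * f 2 + 1) \<and> f' 8 = cotree_vcc l"
proof -
  let ?a = "3 * f 2 + 1" and ?sp = "f 1"
  obtain f1 where 1: "reaches w tcl_program 12 \<lparr>pc = 4, regs = f, mem = m\<rparr>
      \<lparr>pc = 4, regs = f1, mem = m(?sp := ?a, ?sp + 1 := 0)\<rparr>"
    "\<forall>r\<in>{0, 3, 10, 11}. f1 r = f r" "f1 1 = ?sp + 3" "f1 2 = m (3 * f 2 + 2)"
    using run_push[of f w m] f m i(1,2) by auto
  have "node_at xs (f1 2) l" "\<forall>j<length xs. (m(?sp := ?a, ?sp + 1 := 0)) j = xs ! j"
    "f1 0 = length xs" "length xs \<le> f1 1" "f1 1 + 3 * num_nodes l < 2 ^ w"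
    "f1 3 = 1" "f1 10 = 0" "f1 11 = 3"
    using 1(2-) m f i by auto
  with assms(1) obtain f2 m2 where 2: "reaches w tcl_program (44 * num_nodes l)
      \<lparr>pc = 4, regs = f1, mem = m(?sp := ?a, ?sp + 1 := 0)\<rparr> \<lparr>pc = 18, regs = f2, mem = m2\<rparr>"
    "\<forall>r\<in>{0, 1, 3, 10, 11}. f2 r = f1 r" "\<forall>j<f1 1. m2 j = (m(?sp := ?a, ?sp + 1 := 0)) j"
    "f2 4 = cotree_vcc l" "f2 5 = cotree_tcl l"
    unfolding evaluates_def by blast
  \<comment> \<open>The frame lies below the pointer \<open>?sp + 3\<close> handed to the left
    child, so it survives, including the 0 that marks the left child as unfinished.\<close>
  have m2: "m2 ?sp = ?a" "m2 (?sp + 1) = 0" "\<forall>j<?sp. m2 j = m j"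
    using 2(3) 1(3) by auto
  define m3 where "m3 = m2(?sp + 1 := cotree_vcc l, ?sp + 2 := cotree_tcl l)"
  obtain f3 where 3: "reaches w tcl_program 13 \<lparr>pc = 18, regs = f2, mem = m2\<rparr>
      \<lparr>pc = 4, regs = f3, mem = m3\<rparr>"
    "\<forall>r\<in>{0, 1, 3, 10, 11}. f3 r = f2 r" "f3 2 = m2 (?a + 2)"
    using run_right[of f2 ?sp w m2 ?a] 2(2-) 1(2-) f i(1) m2 unfolding m3_def by auto
  have m3: "m3 ?sp = ?a" "m3 (?sp + 1) = cotree_vcc l" "m3 (?sp + 2) = cotree_tcl l"
    "\<forall>j<?sp. m3 j = m j"
    using m2 unfolding m3_def by auto
  \<comment> \<open>\<open>?a + 2\<close> is the input address \<open>3 * f 2 + 3\<close>; it lies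
    below the stack and still holds the number of the right child.\<close>
  have "node_at xs (f3 2) r" "\<forall>j<length xs. m3 j = xs ! j"
    "f3 0 = length xs" "length xs \<le> f3 1" "f3 1 + 3 * num_nodes r < 2 ^ w"
    "f3 3 = 1" "f3 10 = 0" "f3 11 = 3"
    using 1(2-) 2(2) 3(2-) m m2 m3 f i by (auto simp: numeral_3_eq_3)
  with assms(2) obtain f4 m4 where 4: "reaches w tcl_program (44 * num_nodes r)
      \<lparr>pc = 4, regs = f3, mem = m3\<rparr> \<lparr>pc = 18, regs = f4, mem = m4\<rparr>"
    "\<forall>r\<in>{0, 1, 3, 10, 11}. f4 r = f3 r" "\<forall>j<f3 1. m4 j = m3 j"
    "f4 4 = cotree_vcc r" "f4 5 = cotree_tcl r"
    unfolding evaluates_def by blast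
  have m4: "m4 ?sp = ?a" "m4 (?sp + 1) = cotree_vcc l" "m4 (?sp + 2) = cotree_tcl l"
    "\<forall>j<?sp. m4 j = m j"
    using 4(3) 3(2) 2(2) 1(3) m3 by auto
  have "num_nodes l < 2 ^ w" using f(3) by (simp add: algebra_simps)
  then have "cotree_tcl l < 2 ^ w"
    using cotree_tcl_le_vcc[of l] cotree_vcc_le_num_nodes[of l] by linarith
  then obtain f5 where 5: "reaches w tcl_program 12 \<lparr>pc = 18, regs = f4, mem = m4\<rparr>
      \<lparr>pc = 40, regs = f5, mem = m4\<rparr>"
    "\<forall>r\<in>{0, 3, 4, 10, 11}. f5 r = f4 r" "f5 1 = ?sp"
    "f5 5 = max (cotree_tcl l) (cotree_tcl r)" "f5 7 = m4 ?a" "f5 8 = cotree_vcc l"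
    using cotree_vcc_pos[of l] run_pop[of f4 ?sp w m4] 4(2-) 3(2) 2(2) 1(2,3) f m4 by auto
  have "reaches w tcl_program (12 + 44 * num_nodes l + 13 + 44 * num_nodes r + 12)
      \<lparr>pc = 4, regs = f, mem = m\<rparr> \<lparr>pc = 40, regs = f5, mem = m4\<rparr>"
    using reaches_trans[OF reaches_trans[OF reaches_trans[OF reaches_trans[OF 1(1) 2(1)] 3(1)] 4(1)]
        5(1)] .
  then have "reaches w tcl_program (37 + 44 * num_nodes l + 44 * num_nodes r)
      \<lparr>pc = 4, regs = f, mem = m\<rparr> \<lparr>pc = 40, regs = f5, mem = m4\<rparr>"
    by (rule reaches_mono) simp
  then show ?thesis
    using 5(2-) 4(2-) 3(2) 2(2) 1(2,3) m4(4) f i(1) m by (intro exI[of _ f5] exI[of _ m4]) auto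
qed

lemma evaluates: "evaluates w xs t"
proof (induction t)
  case (Leaf v)
  show ?case
    unfolding evaluates_def
  proof (intro allI impI, elim conjE)
    fix f :: "nat \<Rightarrow> nat" and m :: "nat \<Rightarrow> nat"
    assume "node_at xs (f 2) (Leaf v)" "\<forall>j<length xs. m j = xs ! j" "length xs \<le> f 1"
      "f 1 + 3 * num_nodes (Leaf v) < 2 ^ w" "f 3 = 1"
    then obtain f' where "reaches w tcl_program 7 \<lparr>pc = 4, regs = f, mem = m\<rparr>
        \<lparr>pc = 18, regs = f', mem = m\<rparr>"
      "\<forall>r\<in>{0, 1, 3, 10, 11}. f' r = f r" "f' 4 = 1" "f' 5 = 1"
      using run_leaf[of w f m] by auto
    then show "\<exists>f' m'. reaches w tcl_program (44 * num_nodes (Leaf v))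
        \<lparr>pc = 4, regs = f, mem = m\<rparr> \<lparr>pc = 18, regs = f', mem = m'\<rparr> \<and>
      (\<forall>r\<in>{0, 1, 3, 10, 11}. f' r = f r) \<and> (\<forall>j<f 1. m' j = m j) \<and>
      f' 4 = cotree_vcc (Leaf v) \<and> f' 5 = cotree_tcl (Leaf v)"
      by (intro exI[of _ f'] exI[of _ m]) (auto intro: reaches_mono)
  qed
next
  case (Node0 l r)
  show ?case
    unfolding evaluates_def
  proof (intro allI impI, elim conjE)
    fix f :: "nat \<Rightarrow> nat" and m :: "nat \<Rightarrow> nat"
    assume a: "node_at xs (f 2) (Node0 l r)" "\<forall>j<length xs. m j = xs ! j" "f 0 = length xs"
      "length xs \<le> f 1" "f 1 + 3 * num_nodes (Node0 l r) < 2 ^ w" "f 3 = 1" "f 10 = 0" "f 11 = 3"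
    then obtain g m' where g: "reaches w tcl_program (37 + 44 * num_nodes l + 44 * num_nodes r)
        \<lparr>pc = 4, regs = f, mem = m\<rparr> \<lparr>pc = 40, regs = g, mem = m'\<rparr>"
      "\<forall>r\<in>{0, 1, 3, 10, 11}. g r = f r" "\<forall>j<f 1. m' j = m j"
      "g 4 = cotree_vcc r" "g 5 = max (cotree_tcl l) (cotree_tcl r)"
      "g 7 = 0" "g 8 = cotree_vcc l"
      using run_children[OF Node0.IH, of f m] by auto
    have "cotree_vcc r + cotree_vcc l < 2 ^ w"
      using cotree_vcc_le_num_nodes[of l] cotree_vcc_le_num_nodes[of r] a(5) by simp
    then obtain f' where f': "reaches w tcl_program 3 \<lparr>pc = 40, regs = g, mem = m'\<rparr>
        \<lparr>pc = 18, regs = f', mem = m'\<rparr>"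
      "\<forall>r\<in>{0, 1, 3, 5, 10, 11}. f' r = g r" "f' 4 = cotree_vcc l + cotree_vcc r"
      using run_union[of g w m'] g(2-) a(7) by auto
    have "reaches w tcl_program (44 * num_nodes (Node0 l r))
        \<lparr>pc = 4, regs = f, mem = m\<rparr> \<lparr>pc = 18, regs = f', mem = m'\<rparr>"
      using reaches_trans[OF g(1) f'(1)] by (rule reaches_mono) simp
    then show "\<exists>f' m'. reaches w tcl_program (44 * num_nodes (Node0 l r))
        \<lparr>pc = 4, regs = f, mem = m\<rparr> \<lparr>pc = 18, regs = f', mem = m'\<rparr> \<and>
      (\<forall>r\<in>{0, 1, 3, 10, 11}. f' r = f r) \<and> (\<forall>j<f 1. m' j = m j) \<and>
      f' 4 = cotree_vcc (Node0 l r) \<and> f' 5 = cotree_tcl (Node0 l r)"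
      using f'(2-) g(2-) by (intro exI[of _ f'] exI[of _ m']) auto
  qed
next
  case (Node1 l r)
  show ?case
    unfolding evaluates_def
  proof (intro allI impI, elim conjE)
    fix f :: "nat \<Rightarrow> nat" and m :: "nat \<Rightarrow> nat"
    assume a: "node_at xs (f 2) (Node1 l r)" "\<forall>j<length xs. m j = xs ! j" "f 0 = length xs"
      "length xs \<le> f 1" "f 1 + 3 * num_nodes (Node1 l r) < 2 ^ w" "f 3 = 1" "f 10 = 0" "f 11 = 3"
    then obtain g m' where g: "reaches w tcl_program (37 + 44 * num_nodes l + 44 * num_nodes r)
        \<lparr>pc = 4, regs = f, mem = m\<rparr> \<lparr>pc = 40, regs = g, mem = m'\<rparr>"
      "\<forall>r\<in>{0, 1, 3, 10, 11}. g r = f r" "\<forall>j<f 1. m' j = m j"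
      "g 4 = cotree_vcc r" "g 5 = max (cotree_tcl l) (cotree_tcl r)"
      "g 7 = 1" "g 8 = cotree_vcc l"
      using run_children[OF Node1.IH, of f m] by auto
    have "cotree_vcc r < 2 ^ w" "cotree_vcc l < 2 ^ w"
      using cotree_vcc_le_num_nodes[of l] cotree_vcc_le_num_nodes[of r] a(5) by simp_all
    then obtain f' where f': "reaches w tcl_program 7 \<lparr>pc = 40, regs = g, mem = m'\<rparr>
        \<lparr>pc = 18, regs = f', mem = m'\<rparr>"
      "\<forall>r\<in>{0, 1, 3, 10, 11}. f' r = g r" "f' 4 = cotree_vcc (Node1 l r)"
      "f' 5 = cotree_tcl (Node1 l r)"
      using run_join[of g w m'] g(2-) a(7) by auto
    have "reaches w tcl_program (44 * num_nodes (Node1 l r))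
        \<lparr>pc = 4, regs = f, mem = m\<rparr> \<lparr>pc = 18, regs = f', mem = m'\<rparr>"
      using reaches_trans[OF g(1) f'(1)] by (rule reaches_mono) simp
    then show "\<exists>f' m'. reaches w tcl_program (44 * num_nodes (Node1 l r))
        \<lparr>pc = 4, regs = f, mem = m\<rparr> \<lparr>pc = 18, regs = f', mem = m'\<rparr> \<and>
      (\<forall>r\<in>{0, 1, 3, 10, 11}. f' r = f r) \<and> (\<forall>j<f 1. m' j = m j) \<and>
      f' 4 = cotree_vcc (Node1 l r) \<and> f' 5 = cotree_tcl (Node1 l r)"
      using f'(2-) g(2-) by (intro exI[of _ f'] exI[of _ m']) auto
  qed
qed

text \<open>With N nodes, the input and the stack together need 6N + 1 words, which is below 9N. The
  start takes 4 steps and the halt 3; since N is at least 1, these 7 are absorbed by raising 44 to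
  51 per node.\<close>

lemma tcl_program_computes:
  assumes "represents_cotree xs t" "9 * num_nodes t < 2 ^ w"
  shows "computes_within w tcl_program xs (cotree_tcl t) (51 * num_nodes t)"
proof -
  define f m where "f = (\<lambda>_::nat. 0::nat)(0 := length xs)"
    and "m = (\<lambda>i. if i < length xs then xs ! i else 0)"
  have len: "length xs = 3 * num_nodes t + 1" "node_at xs (xs ! 0) t"
    using assms(1) by (simp_all add: represents_cotree_def)
  have pos: "1 \<le> num_nodes t" by (cases t) auto
  have "3 < (2::nat) ^ w" using assms(2) pos by linarith
  then obtain f1 where 1: "reaches w tcl_program 4 \<lparr>pc = 0, regs = f, mem = m\<rparr>
      \<lparr>pc = 4, regs = f1, mem = m\<rparr>"
    "f1 0 = length xs" "f1 1 = length xs" "f1 2 = xs ! 0" "f1 3 = 1" "f1 10 = 0" "f1 11 = 3"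
    using run_start[of w f m] len(1) assms(2) pos unfolding f_def m_def by auto
  then obtain f2 m2 where 2: "reaches w tcl_program (44 * num_nodes t)
      \<lparr>pc = 4, regs = f1, mem = m\<rparr> \<lparr>pc = 18, regs = f2, mem = m2\<rparr>"
    "\<forall>r\<in>{0, 1, 3, 10, 11}. f2 r = f1 r" "f2 5 = cotree_tcl t"
    using evaluates[of w xs t, unfolded evaluates_def, rule_format, of f1 m] len assms(2) pos
    unfolding m_def by auto
  have "cotree_tcl t < 2 ^ w"
    using cotree_tcl_le_vcc[of t] cotree_vcc_le_num_nodes[of t] assms(2) by linarith
  then obtain f3 where 3: "reaches w tcl_program 3 \<lparr>pc = 18, regs = f2, mem = m2\<rparr>
      \<lparr>pc = 52, regs = f3, mem = m2\<rparr>" "f3 0 = cotree_tcl t"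
    using run_halt[of f2 w m2] 1(2-) 2(2-) by auto
  have "reaches w tcl_program (4 + 44 * num_nodes t + 3) (init_state xs)
      \<lparr>pc = 52, regs = f3, mem = m2\<rparr>"
    unfolding init_state_def f_def[symmetric] m_def[symmetric]
    by (rule reaches_trans[OF reaches_trans[OF 1(1) 2(1)] 3(1)])
  then have "reaches w tcl_program (51 * num_nodes t) (init_state xs)
      \<lparr>pc = 52, regs = f3, mem = m2\<rparr>"
    by (rule reaches_mono) (use pos in simp)
  then show ?thesis
    by (rule computes_withinI) (simp_all add: halted_def length_tcl_program 3(2))
qed

theorem theorem13:
  shows "\<exists>(P :: instr list) (T :: nat \<Rightarrow> nat) (c :: nat).
    (\<lambda>n. real (T n)) \<in> O(\<lambda>n. real n) \<and>
    (\<forall>(G :: nat graph) (t :: nat cotree) (n :: nat) (w :: nat) (xs :: nat list).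
       cograph G \<and> card (verts G) = n \<and> binary_cotree t G \<and>
       c * n \<le> 2 ^ w \<and> (\<forall>x\<in>set xs. x < 2 ^ w) \<and> represents_cotree xs t
       \<longrightarrow> computes_within w P xs (tcl G) (T n))"
proof (rule exI[of _ tcl_program], rule exI[of _ "\<lambda>n. 51 * (2 * n - 1)"], rule exI[of _ 18],
    intro conjI allI impI)
  show "(\<lambda>n. real (51 * (2 * n - 1))) \<in> O(\<lambda>n. real n)"
    \<comment> \<open>The bound holds for every \<open>n\<close>, including 0, where truncated
      subtraction yields 0.\<close>
    by (rule bigoI[of _ 102], rule always_eventually) auto
next
  fix G :: "nat graph" and t :: "nat cotree" and n w xs
  assume a: "cograph G \<and> card (verts G) = n \<and> binary_cotree t G \<and>
    18 * n \<le> 2 ^ w \<and> (\<forall>x\<in>set xs. x < 2 ^ w) \<and> represents_cotree xs t"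
  \<comment> \<open>A binary tree with n leaves has 2n - 1 nodes. This fixes the time bound, and the
    constant 18 too, since 9(2n - 1) < 18n.\<close>
  have "num_nodes t + 1 = 2 * n" using a binary_cotree_num_nodes[of t G] by blast
  then have "num_nodes t = 2 * n - 1" "9 * num_nodes t < 2 ^ w" using a by linarith+
  then show "computes_within w tcl_program xs (tcl G) (51 * (2 * n - 1))"
    using tcl_program_computes[of xs t w] binary_cotree_tcl[of t G] a by simp
qed

end
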